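(* There is an algorithm which, given a 2-XOR-CNF formula $\varphi$, generates all maximal signatures of $\varphi$ with polynomial delay; likewise there is a polynomial-delay algorithm generating all minimal signatures of a 2-XOR-CNF.
   Context: An XOR-clause over Boolean variables $V$ is a linear equation $x_{i_1} + \dots + x_{i_k} = \varepsilon$ over $\mathrm{GF}(2)$, $\varepsilon\in\{0,1\}$; a 2-XOR-CNF is a conjunction $\varphi = C_1\land\dots\land C_m$ of XOR-clauses each involving at most two variables (i.e. clauses of the forms $x=y$, $x\neq y$, $x=1$, $x=0$). For an assignment $a\colon V\to\{0,1\}$, $C_i(a)=1$ if $C_i$ holds under $a$ and $0$ otherwise; the signature produced by $a$ is $(C_1(a),\dots,C_m(a))\in\{0,1\}^m$, and the signatures of $\varphi$ are all sequences so produced. Sequences are ordered bitwise ($\sigma\le\tau$ iff $\sigma[i]\le\tau[i]$ for all $i$); minimal/maximal signatures are minimal/maximal elements for $\le$ among signatures of $\varphi$. Polynomial delay: the time before the first output, between consecutive outputs, and after the last output is polynomial in the input size. *)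

theory Defs
  imports
    "HOL-Library.Z2"
    "HOL-Library.Log_Nat"
    "HOL-Computational_Algebra.Polynomial"
begin

section \<open>XOR formulas and their signatures\<close>

text \<open>
  The pair \<^term>\<open>([x\<^sub>1, x\<^sub>2], e) :: nat list \<times> bit\<close> is the equation \<open>x\<^sub>1 + x\<^sub>2 = e\<close> over
  \<open>GF(2)\<close>, with variables named by natural numbers. Assignments are total on \<^typ>\<open>nat\<close>;
  only the values at variables that occur in the formula matter.
\<close>

type_synonym xor_clause = "nat list \<times> bit"

type_synonym xor_cnf = "xor_clause list"

definition holds :: "(nat \<Rightarrow> bit) \<Rightarrow> xor_clause \<Rightarrow> bool" where
  "holds a C \<longleftrightarrow> sum_list (map a (fst C)) = snd C"

definition two_xor_cnf :: "xor_cnf \<Rightarrow> bool" where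
  "two_xor_cnf \<phi> \<longleftrightarrow> (\<forall>C\<in>set \<phi>. length (fst C) \<le> 2)"

definition signature :: "xor_cnf \<Rightarrow> (nat \<Rightarrow> bit) \<Rightarrow> nat list" where
  "signature \<phi> a = map (\<lambda>C. of_bool (holds a C)) \<phi>"

definition signatures :: "xor_cnf \<Rightarrow> nat list set" where
  "signatures \<phi> = range (signature \<phi>)"

definition bitwise_le :: "nat list \<Rightarrow> nat list \<Rightarrow> bool" where
  "bitwise_le = list_all2 (\<le>)"

definition maximal_signatures :: "xor_cnf \<Rightarrow> nat list set" where
  "maximal_signatures \<phi> =
     {\<sigma> \<in> signatures \<phi>. \<forall>\<tau>\<in>signatures \<phi>. bitwise_le \<sigma> \<tau> \<longrightarrow> \<tau> = \<sigma>}"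

definition minimal_signatures :: "xor_cnf \<Rightarrow> nat list set" where
  "minimal_signatures \<phi> =
     {\<sigma> \<in> signatures \<phi>. \<forall>\<tau>\<in>signatures \<phi>. bitwise_le \<tau> \<sigma> \<longrightarrow> \<tau> = \<sigma>}"

section \<open>Random access machines with logarithmic cost\<close>

text \<open>
  The machine has registers, a random access memory, and a write-only output buffer. Instructions
  are charged the binary length of the numbers and addresses they handle. Unit cost would not be
  adequate for polynomial delay: an enumeration may run for exponentially many steps, and repeated
  addition could then produce numbers of exponential length that are handled in a single step.
  Control flow is structured instead of being given by jumps.

  \<open>Emit\<close> outputs the contents of the buffer as one solution and clears the buffer; \<open>outs\<close> records
  all solutions output so far, each with the time of its output.
\<close>

record state =
  regs :: "nat \<Rightarrow> nat"
  mem :: "nat \<Rightarrow> nat"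
  buf :: "nat list"
  clock :: nat
  outs :: "(nat \<times> nat list) list"

datatype instr =
    Nop
  | Const nat nat
  | Move nat nat
  | Add nat nat nat
  | Sub nat nat nat
  | Load nat nat
  | Store nat nat
  | Write nat
  | Emit

datatype com =
    Do instr
  | Seq com com
  | Cond nat com com
  | While nat com

definition word_size :: "nat \<Rightarrow> nat" where
  "word_size n = max 1 (floorlog 2 n)"

definition tick :: "nat \<Rightarrow> state \<Rightarrow> state" where
  "tick k s = s\<lparr>clock := clock s + k\<rparr>"

fun cost :: "instr \<Rightarrow> state \<Rightarrow> nat" where
  "cost Nop s = 1"
| "cost (Const i n) s = word_size n"
| "cost (Move i j) s = word_size (regs s j)"
| "cost (Add i j k) s = word_size (regs s j) + word_size (regs s k)"
| "cost (Sub i j k) s = word_size (regs s j) + word_size (regs s k)"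
| "cost (Load i j) s = word_size (regs s j) + word_size (mem s (regs s j))"
| "cost (Store i j) s = word_size (regs s i) + word_size (regs s j)"
| "cost (Write i) s = word_size (regs s i)"
| "cost Emit s = 1"

fun effect :: "instr \<Rightarrow> state \<Rightarrow> state" where
  "effect Nop s = s"
| "effect (Const i n) s = s\<lparr>regs := (regs s)(i := n)\<rparr>"
| "effect (Move i j) s = s\<lparr>regs := (regs s)(i := regs s j)\<rparr>"
| "effect (Add i j k) s = s\<lparr>regs := (regs s)(i := regs s j + regs s k)\<rparr>"
| "effect (Sub i j k) s = s\<lparr>regs := (regs s)(i := regs s j - regs s k)\<rparr>"
| "effect (Load i j) s = s\<lparr>regs := (regs s)(i := mem s (regs s j))\<rparr>"
| "effect (Store i j) s = s\<lparr>mem := (mem s)(regs s i := regs s j)\<rparr>"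
| "effect (Write i) s = s\<lparr>buf := buf s @ [regs s i]\<rparr>"
| "effect Emit s = s\<lparr>outs := outs s @ [(clock s, buf s)], buf := []\<rparr>"

text \<open>A register that is tested counts as true if it is nonzero.\<close>

inductive exec :: "com \<Rightarrow> state \<Rightarrow> state \<Rightarrow> bool" where
  Do: "exec (Do i) s (effect i (tick (cost i s) s))"
| Seq: "exec c s s' \<Longrightarrow> exec d s' s'' \<Longrightarrow> exec (Seq c d) s s''"
| CondTrue: "regs s r \<noteq> 0 \<Longrightarrow> exec c (tick (word_size (regs s r)) s) s'
    \<Longrightarrow> exec (Cond r c d) s s'"
| CondFalse: "regs s r = 0 \<Longrightarrow> exec d (tick (word_size (regs s r)) s) s'
    \<Longrightarrow> exec (Cond r c d) s s'"
| WhileFalse: "regs s r = 0 \<Longrightarrow> exec (While r c) s (tick (word_size (regs s r)) s)"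
| WhileTrue: "regs s r \<noteq> 0 \<Longrightarrow> exec c (tick (word_size (regs s r)) s) s'
    \<Longrightarrow> exec (While r c) s' s'' \<Longrightarrow> exec (While r c) s s''"

inductive_cases exec_DoE: "exec (Do i) s t"
inductive_cases exec_SeqE: "exec (Seq c d) s t"
inductive_cases exec_CondE: "exec (Cond r c d) s t"
inductive_cases exec_WhileE: "exec (While r c) s t"

lemma exec_deterministic: "exec c s t \<Longrightarrow> exec c s u \<Longrightarrow> u = t"
proof (induction arbitrary: u rule: exec.induct)
  case (Do i s)
  then show ?case by (auto elim: exec_DoE)
next
  case (Seq c s s' d s'')
  from Seq.prems show ?case by (rule exec_SeqE) (metis Seq.IH)
next
  case (CondTrue s r c s' d)
  from CondTrue.prems show ?case by (rule exec_CondE) (metis CondTrue.IH, metis CondTrue.hyps(1))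
next
  case (CondFalse s r d s' c)
  from CondFalse.prems show ?case by (rule exec_CondE)
    (metis CondFalse.hyps(1) less_irrefl, metis CondFalse.IH CondFalse.hyps(1))
next
  case (WhileFalse s r c)
  from WhileFalse.prems show ?case by (rule exec_WhileE)
    (metis WhileFalse.hyps, metis WhileFalse.hyps less_irrefl)
next
  case (WhileTrue s r c s' s'')
  from WhileTrue.prems show ?case by (rule exec_WhileE) (metis WhileTrue.hyps(1), metis WhileTrue.IH)
qed

section \<open>Enumeration with polynomial delay\<close>

definition initial_state :: "nat list \<Rightarrow> state" where
  "initial_state ws =
     \<lparr>regs = (\<lambda>_. 0), mem = (\<lambda>i. if i < length ws then ws ! i else 0),
      buf = [], clock = 0, outs = []\<rparr>"

definition input_size :: "nat list \<Rightarrow> nat" where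
  "input_size ws = sum_list (map word_size ws)"

text \<open>
  The list of times below consists of the start, all output times, and the halting time, so
  the bound covers the time before the first output, between consecutive outputs, and after the
  last output.
\<close>

definition delay_at_most :: "nat \<Rightarrow> state \<Rightarrow> bool" where
  "delay_at_most d s \<longleftrightarrow>
     successively (\<lambda>t u. u \<le> t + d) (0 # map fst (outs s) @ [clock s])"

definition enumerates_with_poly_delay ::
    "com \<Rightarrow> 'a set \<Rightarrow> ('a \<Rightarrow> nat list) \<Rightarrow> ('a \<Rightarrow> nat list set) \<Rightarrow> bool" where
  "enumerates_with_poly_delay c X enc sols \<longleftrightarrow>
     (\<exists>p :: nat poly. \<forall>x\<in>X. \<exists>s.
        exec c (initial_state (enc x)) s \<and>
        distinct (map snd (outs s)) \<and>
        set (map snd (outs s)) = sols x \<and>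
        delay_at_most (poly p (input_size (enc x))) s)"

text \<open>
  Input format: the number of clauses, followed for each clause by its number of variables, these
  variables, and its right-hand side.
\<close>

definition encode_clause :: "xor_clause \<Rightarrow> nat list" where
  "encode_clause C = length (fst C) # fst C @ [of_bool (snd C = 1)]"

definition encode_cnf :: "xor_cnf \<Rightarrow> nat list" where
  "encode_cnf \<phi> = length \<phi> # concat (map encode_clause \<phi>)"

end

theory Submission
  imports Defs
begin

text \<open>
  A clause \<open>x + y = \<epsilon>\<close> is an edge of a graph on the variables and one more vertex for the constant
  \<open>0\<close>, and an assignment is maximal iff the edges it satisfies connect every component of this graph.
  Starting from any assignment, a maximal one that satisfies at least the same clauses is found by
  merging the components of satisfied edges along the remaining clauses, flipping one side if
  necessary.

  Given two maximal assignments \<open>a\<close> and \<open>b\<close> with different signatures, consider the vertices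
  connected to a root of their component by edges that both satisfy. Some edge satisfied by \<open>b\<close>
  leaves this set. Flipping \<open>a\<close> at its outer endpoint and completing again enlarges the set. Hence
  all maximal signatures are reachable from any one of them by flips of a single vertex followed by
  completion, and a breadth-first search with one output per dequeued signature has polynomial
  delay. The table of visited signatures is addressed directly by the signatures read as binary
  numbers, whose length is linear in the number of clauses.

  Negating all right-hand sides complements the signatures, which covers the minimal ones.
\<close>

section \<open>Maximal assignments of a clause graph\<close>

lemma equiv_transversal:
  assumes "equiv UNIV r"
  obtains T where "\<And>x. \<exists>!t. t \<in> T \<and> (t, x) \<in> r"
proof -
  define rep where "rep x = (SOME t. (t, x) \<in> r)" for x
  have rep_related: "(rep x, x) \<in> r" for x
    unfolding rep_def by (rule someI[of _ x]) (use assms in \<open>auto simp: equiv_def refl_on_def\<close>)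
  have rep_eq: "rep x = rep y" if "(x, y) \<in> r" for x y
  proof -
    have "(t, x) \<in> r \<longleftrightarrow> (t, y) \<in> r" for t
      using assms that by (meson equivE symE transE)
    then show ?thesis by (simp add: rep_def)
  qed
  have "\<exists>!t. t \<in> range rep \<and> (t, x) \<in> r" for x
  proof (rule ex1I[of _ "rep x"])
    fix t assume "t \<in> range rep \<and> (t, x) \<in> r"
    then show "t = rep x" using rep_eq rep_related by (metis rangeE)
  qed (use rep_related in blast)
  with that show thesis .
qed

locale clause_graph =
  fixes m :: nat and U V :: "nat \<Rightarrow> 'v" and E :: "nat \<Rightarrow> bool"
begin

definition sat :: "('v \<Rightarrow> bool) \<Rightarrow> nat \<Rightarrow> bool" where
  "sat a j \<longleftrightarrow> (a (U j) \<noteq> a (V j)) = E j"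

definition sig :: "('v \<Rightarrow> bool) \<Rightarrow> bool list" where
  "sig a = map (sat a) [0..<m]"

definition maximal :: "('v \<Rightarrow> bool) \<Rightarrow> bool" where
  "maximal a \<longleftrightarrow> (\<forall>b. (\<forall>j<m. sat a j \<longrightarrow> sat b j) \<longrightarrow> (\<forall>j<m. sat b j \<longrightarrow> sat a j))"

definition maximal_sigs :: "bool list set" where
  "maximal_sigs = sig ` Collect maximal"

definition verts :: "'v set" where
  "verts = U ` {..<m} \<union> V ` {..<m}"

lemma length_sig [simp]: "length (sig a) = m"
  by (simp add: sig_def)

lemma nth_sig [simp]: "j < m \<Longrightarrow> sig a ! j = sat a j"
  by (simp add: sig_def)

lemma sig_eq_iff: "sig a = sig b \<longleftrightarrow> (\<forall>j<m. sat a j = sat b j)"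
  by (auto simp: list_eq_iff_nth_eq)

lemma finite_verts [simp]: "finite verts"
  by (simp add: verts_def)

lemma verts_endpoints: "j < m \<Longrightarrow> U j \<in> verts" "j < m \<Longrightarrow> V j \<in> verts"
  by (auto simp: verts_def)

lemma maximal_sigs_subset: "maximal_sigs \<subseteq> {\<sigma>. set \<sigma> \<subseteq> UNIV \<and> length \<sigma> = m}"
  by (auto simp: maximal_sigs_def)

lemma length_maximal_sigs: "\<sigma> \<in> maximal_sigs \<Longrightarrow> length \<sigma> = m"
  using maximal_sigs_subset by blast

lemma finite_maximal_sigs: "finite maximal_sigs"
  using maximal_sigs_subset finite_lists_length_eq[OF finite] by (rule finite_subset)

lemma card_maximal_sigs: "card maximal_sigs \<le> 2 ^ m"
  using card_mono[OF finite_lists_length_eq[OF finite] maximal_sigs_subset]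
  by (simp add: card_lists_length_eq[of UNIV, simplified])

subsection \<open>Greedy completion\<close>

text \<open>
  A pair \<open>(l, a)\<close> consists of component labels and an assignment; only the values of \<open>a\<close> relative
  to each other inside a component are meaningful.
\<close>

definition joined :: "('v \<Rightarrow> 'v) \<times> ('v \<Rightarrow> bool) \<Rightarrow> nat \<Rightarrow> bool" where
  "joined p j \<longleftrightarrow> fst p (U j) = fst p (V j)"

definition merge :: "nat \<Rightarrow> ('v \<Rightarrow> 'v) \<times> ('v \<Rightarrow> bool) \<Rightarrow> ('v \<Rightarrow> 'v) \<times> ('v \<Rightarrow> bool)" where
  "merge j p = (if joined p j then p
     else (\<lambda>w. if fst p w = fst p (U j) then fst p (V j) else fst p w,
           \<lambda>w. if fst p w = fst p (U j) \<and> \<not> sat (snd p) j then \<not> snd p w else snd p w))"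

definition discrete :: "('v \<Rightarrow> 'v) \<times> ('v \<Rightarrow> bool)" where
  "discrete = (\<lambda>w. w, \<lambda>_. False)"

definition merge_all :: "(nat \<Rightarrow> bool) \<Rightarrow> ('v \<Rightarrow> 'v) \<times> ('v \<Rightarrow> bool)" where
  "merge_all F = fold merge [0..<m] (fold merge (filter F [0..<m]) discrete)"

definition completion :: "(nat \<Rightarrow> bool) \<Rightarrow> bool list" where
  "completion F = sig (snd (merge_all F))"

definition agrees :: "('v \<Rightarrow> bool) \<Rightarrow> ('v \<Rightarrow> 'v) \<times> ('v \<Rightarrow> bool) \<Rightarrow> bool" where
  "agrees b p \<longleftrightarrow> (\<forall>w w'. fst p w = fst p w' \<longrightarrow> (snd p w \<noteq> snd p w') = (b w \<noteq> b w'))"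

lemma merge_same_label:
  assumes "fst p w = fst p w'"
  shows "fst (merge j p) w = fst (merge j p) w'"
    and "(snd (merge j p) w \<noteq> snd (merge j p) w') = (snd p w \<noteq> snd p w')"
  using assms by (auto simp: merge_def)

lemma joined_merge: "joined p i \<Longrightarrow> joined (merge j p) i"
  unfolding joined_def by (rule merge_same_label(1))

lemma sat_merge: "joined p i \<Longrightarrow> sat (snd (merge j p)) i = sat (snd p) i"
  unfolding joined_def sat_def by (simp only: merge_same_label(2))

lemma joined_merge_self: "joined (merge j p) j"
  by (auto simp: merge_def joined_def)

lemma sat_merge_self: "\<not> joined p j \<Longrightarrow> sat (snd (merge j p)) j"
  by (auto simp: merge_def joined_def sat_def)

lemma joined_fold_merge: "joined p i \<Longrightarrow> joined (fold merge js p) i"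
  by (induction js arbitrary: p) (simp_all add: joined_merge)

lemma sat_fold_merge: "joined p i \<Longrightarrow> sat (snd (fold merge js p)) i = sat (snd p) i"
  by (induction js arbitrary: p) (simp_all add: joined_merge sat_merge)

lemma joined_fold_merge_mem: "j \<in> set js \<Longrightarrow> joined (fold merge js p) j"
proof (induction js arbitrary: p)
  case (Cons i js)
  then show ?case by (cases "j = i") (simp_all add: joined_fold_merge joined_merge_self)
qed simp

lemma agrees_discrete: "agrees b discrete"
  by (simp add: agrees_def discrete_def)

lemma agrees_sat: "agrees b p \<Longrightarrow> joined p j \<Longrightarrow> sat (snd p) j = sat b j"
  unfolding agrees_def joined_def sat_def by metis

lemma agrees_merge:
  assumes "agrees b p" "sat b j"
  shows "agrees b (merge j p)"
proof (cases "joined p j")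
  case False
  have old: "(snd p w \<noteq> snd p w') = (b w \<noteq> b w')" if "fst p w = fst p w'" for w w'
    using assms(1) that by (simp add: agrees_def)
  have cross: "(snd (merge j p) w \<noteq> snd (merge j p) w') = (b w \<noteq> b w')"
    if "fst p w = fst p (U j)" "fst p w' = fst p (V j)" for w w'
    using False old[OF that(1)] old[OF that(2)] that assms(2)
    by (auto simp: merge_def joined_def sat_def)
  show ?thesis
    unfolding agrees_def
  proof (intro allI impI)
    fix w w' assume same_label: "fst (merge j p) w = fst (merge j p) w'"
    show "(snd (merge j p) w \<noteq> snd (merge j p) w') = (b w \<noteq> b w')"
    proof (cases "fst p w = fst p w'")
      case True
      then show ?thesis using merge_same_label(2)[OF True] old[OF True] by simp
    next
      case False
      then consider "fst p w = fst p (U j)" "fst p w' = fst p (V j)"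
        | "fst p w' = fst p (U j)" "fst p w = fst p (V j)"
        using same_label by (auto simp: merge_def split: if_splits)
      then show ?thesis
        by cases (use cross[of w w'] cross[of w' w] in auto)
    qed
  qed
qed (simp add: merge_def assms(1))

text \<open>
  A merge along a clause satisfies it, so an assignment that satisfies all clauses satisfied in
  the end satisfies every clause along which components were merged.
\<close>

lemma agrees_fold_merge:
  assumes "agrees b p" "\<And>j. j \<in> set js \<Longrightarrow> sat (snd (fold merge js p)) j \<Longrightarrow> sat b j"
  shows "agrees b (fold merge js p)"
  using assms
proof (induction js arbitrary: p)
  case (Cons j js)
  have "agrees b (merge j p)"
  proof (cases "joined p j")
    case False
    then have "sat (snd (fold merge (j # js) p)) j"
      by (simp add: sat_fold_merge joined_merge_self sat_merge_self)
    then show ?thesis using Cons.prems by (intro agrees_merge) simp_all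
  qed (simp add: merge_def Cons.prems(1))
  then show ?case using Cons by simp
qed simp

lemma joined_merge_all: "j < m \<Longrightarrow> joined (merge_all F) j"
  unfolding merge_all_def by (rule joined_fold_merge_mem) simp

lemma sat_merge_all:
  assumes "\<And>i. i < m \<Longrightarrow> F i \<Longrightarrow> sat b i" "j < m" "F j"
  shows "sat (snd (merge_all F)) j"
proof -
  let ?p = "fold merge (filter F [0..<m]) discrete"
  have "agrees b ?p"
    by (rule agrees_fold_merge[OF agrees_discrete]) (use assms(1) in auto)
  moreover have "joined ?p j"
    by (rule joined_fold_merge_mem) (use assms in simp)
  ultimately show ?thesis
    using assms by (simp add: merge_all_def sat_fold_merge agrees_sat)
qed

lemma maximal_merge_all: "maximal (snd (merge_all F))"
  unfolding maximal_def
proof (intro allI impI)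
  fix b j
  assume dominates: "\<forall>j<m. sat (snd (merge_all F)) j \<longrightarrow> sat b j" and "j < m" "sat b j"
  have "merge_all F = fold merge (filter F [0..<m] @ [0..<m]) discrete"
    by (simp add: merge_all_def)
  then have "agrees b (merge_all F)"
    using dominates agrees_fold_merge[OF agrees_discrete, of "filter F [0..<m] @ [0..<m]" b]
    by auto
  then show "sat (snd (merge_all F)) j"
    using \<open>j < m\<close> \<open>sat b j\<close> by (simp add: agrees_sat joined_merge_all)
qed

lemma completion_maximal: "completion F \<in> maximal_sigs"
  by (simp add: completion_def maximal_sigs_def maximal_merge_all)

subsection \<open>Reachability by vertex flips\<close>

definition flip :: "'v set \<Rightarrow> ('v \<Rightarrow> bool) \<Rightarrow> 'v \<Rightarrow> bool" where
  "flip D a w \<longleftrightarrow> a w \<noteq> (w \<in> D)"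

definition flip_sig :: "'v \<Rightarrow> bool list \<Rightarrow> nat \<Rightarrow> bool" where
  "flip_sig v \<sigma> j \<longleftrightarrow> (\<sigma> ! j \<noteq> (U j = v)) \<noteq> (V j = v)"

definition links :: "(nat \<Rightarrow> bool) \<Rightarrow> ('v \<times> 'v) set" where
  "links P = {(u, v). \<exists>j<m. P j \<and> (u = U j \<and> v = V j \<or> u = V j \<and> v = U j)}"

lemma sat_flip: "sat (flip D a) j \<longleftrightarrow> sat a j = ((U j \<in> D) = (V j \<in> D))"
  by (auto simp: sat_def flip_def)

lemma flip_sig_sig: "j < m \<Longrightarrow> flip_sig v (sig a) j = sat (flip {v} a) j"
  by (auto simp: flip_sig_def sat_flip)

lemma links_mono: "(\<And>j. j < m \<Longrightarrow> P j \<Longrightarrow> Q j) \<Longrightarrow> links P \<subseteq> links Q"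
  by (auto simp: links_def)

lemma links_verts: "(u, v) \<in> links P \<Longrightarrow> v \<in> verts"
  by (auto simp: links_def verts_def)

lemma equiv_rtrancl_links: "equiv UNIV ((links P)\<^sup>*)"
proof -
  have "sym (links P)" by (auto simp: links_def sym_def)
  then show ?thesis by (intro equivI refl_rtrancl sym_rtrancl trans_rtrancl) auto
qed

lemma links_rtrancl_sym: "(u, v) \<in> (links P)\<^sup>* \<Longrightarrow> (v, u) \<in> (links P)\<^sup>*"
  using equiv_rtrancl_links by (meson equivE symE)

lemma links_rtrancl_agree:
  assumes "(u, v) \<in> (links (\<lambda>j. sat a j \<and> sat b j))\<^sup>*"
  shows "(a u \<noteq> a v) = (b u \<noteq> b v)"
  using assms by (induction rule: rtrancl_induct) (auto simp: links_def sat_def)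

text \<open>Otherwise flipping the component of one endpoint would satisfy an additional clause.\<close>

lemma maximal_connects_endpoints:
  assumes "maximal a" "j < m"
  shows "(U j, V j) \<in> (links (sat a))\<^sup>*"
proof (rule ccontr)
  assume apart: "(U j, V j) \<notin> (links (sat a))\<^sup>*"
  define D where "D = (links (sat a))\<^sup>* `` {U j}"
  have "sat (flip D a) i" if "i < m" "sat a i" for i
  proof -
    have "(U i, V i) \<in> links (sat a)" "(V i, U i) \<in> links (sat a)"
      using that by (auto simp: links_def)
    then have "U i \<in> D \<longleftrightarrow> V i \<in> D"
      unfolding D_def by (meson Image_singleton_iff rtrancl.rtrancl_into_rtrancl)
    with that show ?thesis by (simp add: sat_flip)
  qed
  moreover have "U j \<in> D" "V j \<notin> D" using apart by (auto simp: D_def)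
  moreover have "\<not> sat a j" using apart assms(2) by (auto simp: links_def)
  ultimately show False
    using assms unfolding maximal_def by (metis sat_flip)
qed

lemma maximal_rtrancl_links:
  assumes "maximal a"
  shows "(links (sat a))\<^sup>* = (links (\<lambda>_. True))\<^sup>*"
proof (rule antisym)
  show "(links (sat a))\<^sup>* \<subseteq> (links (\<lambda>_. True))\<^sup>*"
    by (intro rtrancl_mono links_mono) simp
  have "links (\<lambda>_. True) \<subseteq> (links (sat a))\<^sup>*"
    using maximal_connects_endpoints[OF assms] links_rtrancl_sym by (auto simp: links_def)
  then show "(links (\<lambda>_. True))\<^sup>* \<subseteq> (links (sat a))\<^sup>*"
    by (rule rtrancl_subset_rtrancl)
qed

definition anchored :: "'v set \<Rightarrow> ('v \<Rightarrow> bool) \<Rightarrow> ('v \<Rightarrow> bool) \<Rightarrow> 'v set" where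
  "anchored T a b = (links (\<lambda>j. sat a j \<and> sat b j))\<^sup>* `` T"

lemma anchored_step:
  assumes "u \<in> anchored T a b" "(u, v) \<in> links (\<lambda>j. sat a j \<and> sat b j)"
  shows "v \<in> anchored T a b"
  using assms unfolding anchored_def by (blast intro: rtrancl_into_rtrancl)

lemma flip_enlarges_anchored:
  assumes inner: "x \<in> anchored T a b" and outer: "y \<notin> anchored T a b"
    and link: "(x, y) \<in> links (sat b)"
    and extends: "\<And>j. j < m \<Longrightarrow> sat (flip {y} a) j \<Longrightarrow> sat a' j"
  shows "insert y (anchored T a b) \<subseteq> anchored T a' b"
proof -
  have keep: "v \<in> anchored T a' b" if "v \<in> anchored T a b" for v
  proof -
    obtain t where "t \<in> T" and path: "(t, v) \<in> (links (\<lambda>j. sat a j \<and> sat b j))\<^sup>*"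
      using \<open>v \<in> anchored T a b\<close> unfolding anchored_def by blast
    from path show ?thesis
    proof (induction rule: rtrancl_induct)
      case base
      show ?case using \<open>t \<in> T\<close> by (auto simp: anchored_def)
    next
      case (step p q)
      have "p \<in> anchored T a b" using step.hyps(1) \<open>t \<in> T\<close> by (auto simp: anchored_def)
      then have "p \<noteq> y" "q \<noteq> y" using outer step.hyps(2) anchored_step by blast+
      then have "(p, q) \<in> links (\<lambda>j. sat a' j \<and> sat b j)"
        using step.hyps(2) extends by (auto simp: links_def sat_flip)
      with step.IH show ?case by (rule anchored_step)
    qed
  qed
  have "(x, y) \<notin> links (\<lambda>j. sat a j \<and> sat b j)" using inner outer anchored_step by blast
  with link obtain i where unsatisfied: "i < m" "\<not> sat a i" "sat b i"
      "x = U i \<and> y = V i \<or> x = V i \<and> y = U i"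
    unfolding links_def by blast
  moreover have "x \<noteq> y" using inner outer by blast
  ultimately have "sat a' i" using extends[of i] by (auto simp: sat_flip)
  with unsatisfied have "(x, y) \<in> links (\<lambda>j. sat a' j \<and> sat b j)"
    by (auto simp: links_def)
  then show ?thesis using keep inner anchored_step by blast
qed

lemma sig_eq_if_anchored:
  assumes transversal: "\<And>v. \<exists>!t. t \<in> T \<and> (t, v) \<in> (links (\<lambda>_. True))\<^sup>*"
    and "verts \<subseteq> anchored T a b"
  shows "sig a = sig b"
  unfolding sig_eq_iff
proof (intro allI impI)
  fix j assume "j < m"
  let ?H = "links (\<lambda>j. sat a j \<and> sat b j)"
  obtain s t where anchors: "s \<in> T" "(s, U j) \<in> ?H\<^sup>*" "t \<in> T" "(t, V j) \<in> ?H\<^sup>*"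
    using assms(2) verts_endpoints[OF \<open>j < m\<close>] unfolding anchored_def by blast
  have "?H\<^sup>* \<subseteq> (links (\<lambda>_. True))\<^sup>*"
    by (intro rtrancl_mono links_mono) simp
  moreover have "(U j, V j) \<in> links (\<lambda>_. True)" using \<open>j < m\<close> by (auto simp: links_def)
  ultimately have "(s, V j) \<in> (links (\<lambda>_. True))\<^sup>*" "(t, V j) \<in> (links (\<lambda>_. True))\<^sup>*"
    using anchors(2,4) by (blast intro: rtrancl_into_rtrancl)+
  then have "s = t" using transversal anchors(1,3) by blast
  then have "(U j, V j) \<in> ?H\<^sup>*"
    using anchors(2,4) links_rtrancl_sym by (meson rtrancl_trans)
  then show "sat a j = sat b j" using links_rtrancl_agree unfolding sat_def by blast
qed

lemma ex_flip_enlarging_anchored: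
  assumes "maximal b" and cover: "\<And>v. \<exists>t\<in>T. (t, v) \<in> (links (\<lambda>_. True))\<^sup>*"
    and "\<not> verts \<subseteq> anchored T a b"
  shows "\<exists>y\<in>verts. y \<notin> anchored T a b \<and>
    insert y (anchored T a b) \<subseteq> anchored T (snd (merge_all (flip_sig y (sig a)))) b"
proof -
  obtain v where "v \<notin> anchored T a b" using assms(3) by blast
  obtain t where "t \<in> T" "(t, v) \<in> (links (sat b))\<^sup>*"
    using cover[of v] maximal_rtrancl_links[OF assms(1)] by blast
  then have "v \<in> (links (sat b))\<^sup>* `` anchored T a b"
    by (auto simp: anchored_def)
  then have "\<not> links (sat b) `` anchored T a b \<subseteq> anchored T a b"
    using \<open>v \<notin> anchored T a b\<close> by (metis Image_closed_trancl)
  then obtain x y where crossing: "x \<in> anchored T a b" "y \<notin> anchored T a b"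
      "(x, y) \<in> links (sat b)"
    by blast
  have "sat (snd (merge_all (flip_sig y (sig a)))) j" if "j < m" "sat (flip {y} a) j" for j
    by (rule sat_merge_all[of _ "flip {y} a"]) (use that flip_sig_sig in auto)
  from flip_enlarges_anchored[OF crossing this] crossing(2) links_verts[OF crossing(3)]
  show ?thesis by blast
qed

lemma closed_maximal_sigs:
  assumes "S \<subseteq> maximal_sigs" "S \<noteq> {}"
    and closed: "\<And>\<sigma> v. \<sigma> \<in> S \<Longrightarrow> v \<in> verts \<Longrightarrow> completion (flip_sig v \<sigma>) \<in> S"
  shows "S = maximal_sigs"
proof (rule antisym[OF assms(1)], rule subsetI)
  fix \<tau> assume "\<tau> \<in> maximal_sigs"
  then obtain b where "maximal b" "\<tau> = sig b" by (auto simp: maximal_sigs_def)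
  obtain T where transversal: "\<And>v. \<exists>!t. t \<in> T \<and> (t, v) \<in> (links (\<lambda>_. True))\<^sup>*"
    using equiv_transversal[OF equiv_rtrancl_links] by blast
  define extent where "extent a = card (anchored T a b \<inter> verts)" for a
  obtain a\<^sub>0 where "maximal a\<^sub>0 \<and> sig a\<^sub>0 \<in> S"
    using assms(1,2) by (auto simp: maximal_sigs_def)
  moreover have "\<forall>a. maximal a \<and> sig a \<in> S \<longrightarrow> extent a < Suc (card verts)"
    by (simp add: extent_def less_Suc_eq_le card_mono)
  ultimately obtain a where "sig a \<in> S"
    and largest: "\<And>a'. maximal a' \<Longrightarrow> sig a' \<in> S \<Longrightarrow> extent a' \<le> extent a"
    using ex_has_greatest_nat[of "\<lambda>a. maximal a \<and> sig a \<in> S" a\<^sub>0 extent "Suc (card verts)"]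
    by blast
  have "verts \<subseteq> anchored T a b"
  proof (rule ccontr)
    assume "\<not> verts \<subseteq> anchored T a b"
    then obtain y where "y \<in> verts" "y \<notin> anchored T a b"
      "insert y (anchored T a b) \<subseteq> anchored T (snd (merge_all (flip_sig y (sig a)))) b"
      using ex_flip_enlarging_anchored[OF \<open>maximal b\<close>] transversal by metis
    then have "extent a < extent (snd (merge_all (flip_sig y (sig a))))"
      unfolding extent_def by (intro psubset_card_mono) auto
    moreover have "sig (snd (merge_all (flip_sig y (sig a)))) \<in> S"
      using closed[OF \<open>sig a \<in> S\<close> \<open>y \<in> verts\<close>] by (simp add: completion_def)
    ultimately show False using largest[OF maximal_merge_all] by fastforce
  qed
  then have "sig a = \<tau>" using sig_eq_if_anchored[OF transversal] \<open>\<tau> = sig b\<close> by blast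
  with \<open>sig a \<in> S\<close> show "\<tau> \<in> S" by simp
qed

end

section \<open>Growth of numbers and running time\<close>

lemma word_size_ge_1: "1 \<le> word_size x"
  by (simp add: word_size_def)

lemma less_exp_word_size: "x < 2 ^ word_size x"
  using floorlog_leD[of 2 x "word_size x"] by (simp add: word_size_def)

lemma word_size_le: "x < 2 ^ w \<Longrightarrow> 1 \<le> w \<Longrightarrow> word_size x \<le> w"
  by (simp add: word_size_def floorlog_leI)

lemma tick_simps [simp]:
  "regs (tick k s) = regs s" "mem (tick k s) = mem s" "buf (tick k s) = buf s"
  "outs (tick k s) = outs s" "clock (tick k s) = clock s + k"
  by (simp_all add: tick_def)

definition bounded :: "nat \<Rightarrow> state \<Rightarrow> bool" where
  "bounded w s \<longleftrightarrow> (\<forall>r. regs s r < 2 ^ w) \<and> (\<forall>i. mem s i < 2 ^ w)"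

lemma bounded_mono: "bounded w s \<Longrightarrow> w \<le> w' \<Longrightarrow> bounded w' s"
  unfolding bounded_def by (meson less_le_trans one_le_numeral power_increasing)

lemma bounded_tick [simp]: "bounded w (tick k s) = bounded w s"
  by (simp add: bounded_def)

text \<open>
  An addition lengthens the longest number by at most one bit, so the cost of \<open>n\<close> steps is
  controlled by \<open>n\<close> and the initial word length alone.
\<close>

definition grows :: "nat \<Rightarrow> state \<Rightarrow> state \<Rightarrow> bool" where
  "grows n s t \<longleftrightarrow>
     (\<forall>w\<ge>3. bounded w s \<longrightarrow> bounded (w + n) t \<and> clock t \<le> clock s + 2 * n * (w + n))"

lemma growsD:
  assumes "grows n s t" "bounded w s" "3 \<le> w"
  shows "bounded (w + n) t" and "clock t \<le> clock s + 2 * n * (w + n)"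
  using assms by (auto simp: grows_def)

lemma grows_mono:
  assumes "grows n s t" "n \<le> n'"
  shows "grows n' s t"
proof -
  have "2 * n * (w + n) \<le> 2 * n' * (w + n')" for w
    using assms(2) by (intro mult_le_mono) auto
  then show ?thesis
    using assms unfolding grows_def by (meson add_left_mono bounded_mono order_trans)
qed

lemma grows_trans:
  assumes "grows a s s'" "grows b s' s''"
  shows "grows (a + b) s s''"
  unfolding grows_def
proof (intro allI impI)
  fix w :: nat assume "3 \<le> w" "bounded w s"
  note first = growsD[OF assms(1) this(2,1)]
  have second: "bounded (w + a + b) s''" "clock s'' \<le> clock s' + 2 * b * (w + a + b)"
    using growsD[OF assms(2) first(1)] \<open>3 \<le> w\<close> by simp_all
  have "2 * a * (w + a) \<le> 2 * a * (w + (a + b))" by (intro mult_le_mono) auto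
  with first(2) second
  show "bounded (w + (a + b)) s'' \<and> clock s'' \<le> clock s + 2 * (a + b) * (w + (a + b))"
    by (simp add: algebra_simps)
qed

lemma grows_test: "grows 1 s (tick (word_size (regs s r)) s)"
  unfolding grows_def
proof (intro allI impI)
  fix w :: nat assume "3 \<le> w" "bounded w s"
  then have "word_size (regs s r) \<le> w" by (intro word_size_le) (auto simp: bounded_def)
  with bounded_mono[OF \<open>bounded w s\<close>, of "w + 1"]
  show "bounded (w + 1) (tick (word_size (regs s r)) s) \<and>
      clock (tick (word_size (regs s r)) s) \<le> clock s + 2 * 1 * (w + 1)"
    by simp
qed

definition step :: "instr \<Rightarrow> state \<Rightarrow> state" where
  "step i s = effect i (tick (cost i s) s)"

lemma clock_step: "clock (step i s) = clock s + cost i s"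
  by (cases i) (simp_all add: step_def)

fun small_const :: "instr \<Rightarrow> bool" where
  "small_const (Const r n) = (n < 8)"
| "small_const _ = True"

lemma bounded_step:
  assumes "small_const i" "3 \<le> w" "bounded w s"
  shows "bounded (w + 1) (step i s)"
proof -
  have below: "regs s r < 2 ^ w" "mem s r < 2 ^ w" for r
    using assms(3) by (auto simp: bounded_def)
  have below_double: "regs s r < 2 * 2 ^ w" "mem s r < 2 * 2 ^ w"
      "regs s r + regs s r' < 2 * 2 ^ w" "regs s r - regs s r' < 2 * 2 ^ w" for r r'
    using below[of r] below[of r'] by linarith+
  have "(2::nat) ^ 3 \<le> 2 ^ w" using assms(2) by (intro power_increasing) auto
  then have "n < 2 * 2 ^ w" if "n < 8" for n :: nat
    using that by auto
  then show ?thesis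
    using assms(1) below_double by (cases i) (auto simp: bounded_def step_def)
qed

lemma cost_le:
  assumes "small_const i" "3 \<le> w" "bounded w s"
  shows "cost i s \<le> 2 * w"
proof -
  have size_le: "word_size (regs s r) \<le> w" "word_size (mem s r) \<le> w" for r
    using assms(2,3) by (auto simp: bounded_def intro: word_size_le)
  have "(2::nat) ^ 3 \<le> 2 ^ w" using assms(2) by (intro power_increasing) auto
  then have "word_size n \<le> w" if "n < 8" for n :: nat
    using that assms(2) by (auto intro: word_size_le)
  then show ?thesis
    using assms(1,2) size_le by (cases i) (auto simp: mult_2 intro: add_mono trans_le_add1)
qed

lemma grows_step: "small_const i \<Longrightarrow> grows 1 s (step i s)"
  unfolding grows_def clock_step using bounded_step[of i _ s] cost_le[of i _ s] by fastforce

subsection \<open>Programs without output\<close>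

definition runs :: "nat \<Rightarrow> com \<Rightarrow> state \<Rightarrow> state \<Rightarrow> bool" where
  "runs n c s t \<longleftrightarrow> exec c s t \<and> outs t = outs s \<and> grows n s t"

lemma runs_mono: "runs n c s t \<Longrightarrow> n \<le> n' \<Longrightarrow> runs n' c s t"
  by (auto simp: runs_def intro: grows_mono)

lemma runs_Do: "small_const i \<Longrightarrow> i \<noteq> Emit \<Longrightarrow> runs 1 (Do i) s (step i s)"
  using exec.Do[of i s] grows_step[of i s] by (cases i) (auto simp: runs_def step_def)

lemma runs_Seq: "runs a c s s' \<Longrightarrow> runs b d s' s'' \<Longrightarrow> runs (a + b) (Seq c d) s s''"
  by (auto simp: runs_def intro: exec.Seq grows_trans)

lemma runs_Cond:
  assumes "runs n (if regs s r \<noteq> 0 then c else d) (tick (word_size (regs s r)) s) t"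
  shows "runs (1 + n) (Cond r c d) s t"
proof -
  have "exec (Cond r c d) s t"
    using assms
    by (cases "regs s r = 0") (auto simp: runs_def intro: exec.CondTrue exec.CondFalse)
  then show ?thesis
    using assms grows_trans[OF grows_test] unfolding runs_def by (metis tick_simps(4))
qed

lemma runs_WhileFalse:
  "regs s r = 0 \<Longrightarrow> runs 1 (While r c) s (tick (word_size (regs s r)) s)"
  unfolding runs_def by (metis exec.WhileFalse grows_test tick_simps(4))

lemma runs_WhileTrue:
  assumes "regs s r \<noteq> 0" "runs a c (tick (word_size (regs s r)) s) s'" "runs b (While r c) s' s''"
  shows "runs (1 + a + b) (While r c) s s''"
  using assms grows_trans[OF grows_trans[OF grows_test]] exec.WhileTrue[OF assms(1)]
  unfolding runs_def by (metis tick_simps(4))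

fun seqs :: "com list \<Rightarrow> com" where
  "seqs [] = Do Nop"
| "seqs (c # cs) = Seq c (seqs cs)"

definition instrs :: "instr list \<Rightarrow> com" where
  "instrs is = seqs (map Do is)"

definition steps :: "instr list \<Rightarrow> state \<Rightarrow> state" where
  "steps is s = step Nop (fold step is s)"

lemma runs_instrs:
  assumes "\<forall>i\<in>set is. small_const i \<and> i \<noteq> Emit" "n = length is + 1"
  shows "runs n (instrs is) s (steps is s)"
  using assms unfolding instrs_def steps_def
proof (induction "is" arbitrary: n s)
  case Nil
  then show ?case using runs_Do[of Nop s] by simp
next
  case (Cons i "is")
  then show ?case
    using runs_Seq[OF runs_Do[of i s] Cons.IH[of "n - 1" "step i s"]] by simp
qed

definition clear :: "nat list \<Rightarrow> com" where
  "clear rs = instrs (map (\<lambda>r. Const r 0) rs)"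

lemma runs_clear:
  assumes "n = length rs + 1"
  obtains t where "runs n (clear rs) s t"
    "regs t = (\<lambda>r. if r \<in> set rs then 0 else regs s r)" "mem t = mem s" "buf t = buf s"
proof -
  let ?is = "map (\<lambda>r. Const r 0) rs"
  have "regs (fold step ?is s) = (\<lambda>r. if r \<in> set rs then 0 else regs s r) \<and>
      mem (fold step ?is s) = mem s \<and> buf (fold step ?is s) = buf s"
    by (induction rs arbitrary: s) (auto simp: step_def)
  with that[of "steps ?is s"] runs_instrs[of ?is n s] assms show thesis
    by (auto simp: clear_def steps_def step_def)
qed

section \<open>A language with bounded loops and arrays\<close>

datatype ('r, 't) op =
    Set_bit 'r bool
  | Incr 'r
  | Decr 'r
  | Set_sum 'r 'r 'r
  | Set_not 'r 'r
  | Set_dist 'r 'r 'r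
  | Get 'r 't 'r
  | Put 't 'r 'r
  | Append 'r

datatype ('r, 't) prog =
    Block "('r, 't) op list"
  | Read 'r 'r
  | Then "('r, 't) prog" "('r, 't) prog" (infixr ";;" 60)
  | When 'r "('r, 't) prog"
  | For 'r "('r, 't) prog"

record ('r, 't) env =
  reg :: "'r \<Rightarrow> nat"
  arr :: "'t \<Rightarrow> nat \<Rightarrow> nat"
  inp :: "nat \<Rightarrow> nat"
  out :: "nat list"

definition set_reg :: "'r \<Rightarrow> nat \<Rightarrow> ('r, 't) env \<Rightarrow> ('r, 't) env" where
  "set_reg r x e = e\<lparr>reg := (reg e)(r := x)\<rparr>"

definition set_arr :: "'t \<Rightarrow> nat \<Rightarrow> nat \<Rightarrow> ('r, 't) env \<Rightarrow> ('r, 't) env" where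
  "set_arr t i x e = e\<lparr>arr := (arr e)(t := (arr e t)(i := x))\<rparr>"

lemma set_reg_simps [simp]:
  "reg (set_reg r x e) r' = (if r' = r then x else reg e r')"
  "arr (set_reg r x e) = arr e" "inp (set_reg r x e) = inp e" "out (set_reg r x e) = out e"
  by (simp_all add: set_reg_def)

lemma set_arr_simps [simp]:
  "arr (set_arr t i x e) t' = (if t' = t then (arr e t)(i := x) else arr e t')"
  "reg (set_arr t i x e) = reg e" "inp (set_arr t i x e) = inp e" "out (set_arr t i x e) = out e"
  by (simp_all add: set_arr_def)

lemma set_reg_twice [simp]: "set_reg r x (set_reg r y e) = set_reg r x e"
  by (simp add: set_reg_def)

definition absdiff :: "nat \<Rightarrow> nat \<Rightarrow> nat" where
  "absdiff x y = (x - y) + (y - x)"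

lemma absdiff_eq_0 [simp]: "absdiff x y = 0 \<longleftrightarrow> x = y"
  by (auto simp: absdiff_def)

lemma absdiff_of_bool [simp]: "absdiff (of_bool a) (of_bool b) = of_bool (a \<noteq> b)"
  by (cases a; cases b) (simp_all add: absdiff_def)

primrec eval_op :: "('r, 't) op \<Rightarrow> ('r, 't) env \<Rightarrow> ('r, 't) env" where
  "eval_op (Set_bit r b) e = set_reg r (of_bool b) e"
| "eval_op (Incr r) e = set_reg r (Suc (reg e r)) e"
| "eval_op (Decr r) e = set_reg r (reg e r - 1) e"
| "eval_op (Set_sum r x y) e = set_reg r (reg e x + reg e y) e"
| "eval_op (Set_not r x) e = set_reg r (of_bool (reg e x = 0)) e"
| "eval_op (Set_dist r x y) e = set_reg r (absdiff (reg e x) (reg e y)) e"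
| "eval_op (Get r t i) e = set_reg r (arr e t (reg e i)) e"
| "eval_op (Put t i r) e = set_arr t (reg e i) (reg e r) e"
| "eval_op (Append r) e = e\<lparr>out := out e @ [reg e r]\<rparr>"

primrec eval :: "nat \<Rightarrow> ('r, 't) prog \<Rightarrow> ('r, 't) env \<Rightarrow> ('r, 't) env" where
  "eval m (Block ops) e = fold eval_op ops e"
| "eval m (Read r p) e = set_reg r (inp e (reg e p)) e"
| "eval m (c ;; d) e = eval m d (eval m c e)"
| "eval m (When r c) e = (if reg e r \<noteq> 0 then eval m c e else e)"
| "eval m (For j c) e = set_reg j m (fold (\<lambda>k e. eval m c (set_reg j k e)) [0..<m] e)"

subsection \<open>Framing\<close>

datatype ('r, 't) loc = Reg 'r | Arr 't | Out

fun op_writes :: "('r, 't) op \<Rightarrow> ('r, 't) loc" where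
  "op_writes (Set_bit r b) = Reg r"
| "op_writes (Incr r) = Reg r"
| "op_writes (Decr r) = Reg r"
| "op_writes (Set_sum r x y) = Reg r"
| "op_writes (Set_not r x) = Reg r"
| "op_writes (Set_dist r x y) = Reg r"
| "op_writes (Get r t i) = Reg r"
| "op_writes (Put t i r) = Arr t"
| "op_writes (Append r) = Out"

primrec writes :: "('r, 't) prog \<Rightarrow> ('r, 't) loc set" where
  "writes (Block ops) = op_writes ` set ops"
| "writes (Read r p) = {Reg r}"
| "writes (c ;; d) = writes c \<union> writes d"
| "writes (When r c) = writes c"
| "writes (For j c) = insert (Reg j) (writes c)"

primrec well_formed :: "('r, 't) prog \<Rightarrow> bool" where
  "well_formed (Block ops) = True"
| "well_formed (Read r p) = True"
| "well_formed (c ;; d) = (well_formed c \<and> well_formed d)"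
| "well_formed (When r c) = well_formed c"
| "well_formed (For j c) = (Reg j \<notin> writes c \<and> well_formed c)"

definition eq_outside :: "('r, 't) loc set \<Rightarrow> ('r, 't) env \<Rightarrow> ('r, 't) env \<Rightarrow> bool" where
  "eq_outside L e e' \<longleftrightarrow>
     (\<forall>r. Reg r \<notin> L \<longrightarrow> reg e' r = reg e r) \<and> (\<forall>t. Arr t \<notin> L \<longrightarrow> arr e' t = arr e t) \<and>
     (Out \<notin> L \<longrightarrow> out e' = out e) \<and> inp e' = inp e"

lemma eq_outside_refl: "eq_outside L e e"
  by (simp add: eq_outside_def)

lemma eq_outside_trans:
  "eq_outside K e e' \<Longrightarrow> eq_outside L e' e'' \<Longrightarrow> K \<subseteq> M \<Longrightarrow> L \<subseteq> M \<Longrightarrow> eq_outside M e e''"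
  by (auto simp: eq_outside_def) (metis subsetD)+

lemma eq_outside_set_reg: "Reg r \<in> L \<Longrightarrow> eq_outside L e (set_reg r x e)"
  by (auto simp: eq_outside_def)

lemma eq_outside_fold:
  assumes "\<And>x e. x \<in> set xs \<Longrightarrow> eq_outside L e (f x e)"
  shows "eq_outside L e (fold f xs e)"
  using assms
proof (induction xs arbitrary: e)
  case (Cons x xs)
  then show ?case by (auto intro: eq_outside_trans[where L = L])
qed (simp add: eq_outside_refl)

lemma eq_outside_eval_op: "eq_outside {op_writes c} e (eval_op c e)"
  by (cases c) (auto simp: eq_outside_def)

lemma eq_outside_eval: "eq_outside (writes c) e (eval m c e)"
proof (induction c arbitrary: e)
  case (Block ops)
  show ?case
    unfolding eval.simps by (rule eq_outside_fold)
      (auto intro: eq_outside_trans[OF eq_outside_refl eq_outside_eval_op])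
next
  case (Then c d)
  then show ?case
    unfolding eval.simps by (rule eq_outside_trans) auto
next
  case (For j c)
  have "eq_outside (writes (For j c)) e (eval m c (set_reg j k e))" for k e
    by (rule eq_outside_trans[OF eq_outside_set_reg For.IH]) auto
  then show ?case
    by (auto intro!: eq_outside_trans[OF eq_outside_fold eq_outside_set_reg])
qed (auto simp: eq_outside_def)

lemma eval_frame:
  "Reg r \<notin> writes c \<Longrightarrow> reg (eval m c e) r = reg e r"
  "Arr t \<notin> writes c \<Longrightarrow> arr (eval m c e) t = arr e t"
  "Out \<notin> writes c \<Longrightarrow> out (eval m c e) = out e"
  "inp (eval m c e) = inp e"
  using eq_outside_eval[of c e m] by (auto simp: eq_outside_def)

definition iterate :: "nat \<Rightarrow> 'r \<Rightarrow> ('r, 't) prog \<Rightarrow> nat \<Rightarrow> ('r, 't) env \<Rightarrow> ('r, 't) env" where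
  "iterate m j c k e = fold (\<lambda>i e. eval m c (set_reg j i e)) [0..<k] e"

lemma iterate_simps [simp]:
  "iterate m j c 0 e = e"
  "iterate m j c (Suc k) e = eval m c (set_reg j k (iterate m j c k e))"
  by (simp_all add: iterate_def)

lemma eval_For: "eval m (For j c) e = set_reg j m (iterate m j c m e)"
  by (simp add: iterate_def)

declare eval.simps(5) [simp del]

lemma eq_outside_iterate: "eq_outside (writes (For j c)) e (set_reg j x (iterate m j c k e))"
proof -
  have "eq_outside (writes (For j c)) e (eval m c (set_reg j i e))" for i e
    by (rule eq_outside_trans[OF eq_outside_set_reg eq_outside_eval]) auto
  then show ?thesis
    unfolding iterate_def
    by (auto intro!: eq_outside_trans[OF eq_outside_fold eq_outside_set_reg])
qed

lemma eval_For_induct: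
  assumes init: "I 0 e"
    and step: "\<And>k e'. k < m \<Longrightarrow> reg e' j = k \<Longrightarrow> eq_outside (writes (For j c)) e e' \<Longrightarrow> I k e'
      \<Longrightarrow> I (Suc k) (eval m c e')"
    and counter: "\<And>k x e'. I k e' \<Longrightarrow> I k (set_reg j x e')"
  shows "I m (eval m (For j c) e)"
proof -
  have "I k (iterate m j c k e)" if "k \<le> m" for k
    using that
  proof (induction k)
    case (Suc k)
    then show ?case
      using step[OF _ _ eq_outside_iterate, of k k] counter by simp
  qed (simp add: init)
  then show ?thesis by (simp add: eval_For counter)
qed

subsection \<open>Compilation\<close>

text \<open>
  The machine registers \<open>0\<close> and \<open>1\<close> are scratch, \<open>2\<close> holds the constant one, \<open>3\<close> holds \<open>m\<close>, and
  \<open>4\<close> holds \<open>B\<close>. Up to eight infinite arrays are interleaved above the address \<open>B\<close>.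
\<close>

locale layout =
  fixes reg_num :: "'r \<Rightarrow> nat" and arr_num :: "'t \<Rightarrow> nat"
  assumes inj_reg_num: "inj reg_num" and reg_num_ge: "5 \<le> reg_num r"
    and inj_arr_num: "inj arr_num" and arr_num_less: "arr_num t < 8"
begin

definition cell :: "nat \<Rightarrow> 't \<Rightarrow> nat \<Rightarrow> nat" where
  "cell B t i = B + 8 * i + arr_num t"

definition addr_instrs :: "'t \<Rightarrow> 'r \<Rightarrow> instr list" where
  "addr_instrs t i = [Add 1 (reg_num i) (reg_num i), Add 1 1 1, Add 1 1 1, Add 1 1 4,
     Const 0 (arr_num t), Add 1 1 0]"

primrec compile_op :: "('r, 't) op \<Rightarrow> instr list" where
  "compile_op (Set_bit r b) = [Const (reg_num r) (of_bool b)]"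
| "compile_op (Incr r) = [Add (reg_num r) (reg_num r) 2]"
| "compile_op (Decr r) = [Sub (reg_num r) (reg_num r) 2]"
| "compile_op (Set_sum r x y) = [Add (reg_num r) (reg_num x) (reg_num y)]"
| "compile_op (Set_not r x) = [Sub (reg_num r) 2 (reg_num x)]"
| "compile_op (Set_dist r x y) =
     [Sub 0 (reg_num x) (reg_num y), Sub 1 (reg_num y) (reg_num x), Add (reg_num r) 0 1]"
| "compile_op (Get r t i) = addr_instrs t i @ [Load (reg_num r) 1]"
| "compile_op (Put t i r) = addr_instrs t i @ [Store 1 (reg_num r)]"
| "compile_op (Append r) = [Write (reg_num r)]"

definition loop_code :: "'r \<Rightarrow> com \<Rightarrow> com" where
  "loop_code j c =
     While 0 (Seq c (instrs [Add (reg_num j) (reg_num j) 2, Sub 0 3 (reg_num j)]))"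

primrec compile :: "('r, 't) prog \<Rightarrow> com" where
  "compile (Block ops) = instrs (concat (map compile_op ops))"
| "compile (Read r p) = Seq (Do (Sub 0 4 (reg_num p)))
     (Cond 0 (Do (Load (reg_num r) (reg_num p))) (Do (Const (reg_num r) 0)))"
| "compile (c ;; d) = Seq (compile c) (compile d)"
| "compile (When r c) = Cond (reg_num r) (compile c) (Do Nop)"
| "compile (For j c) =
     Seq (instrs [Const (reg_num j) 0, Sub 0 3 (reg_num j)]) (loop_code j (compile c))"

end

primrec step_count :: "('r, 't) prog \<Rightarrow> nat poly" where
  "step_count (Block ops) = [:7 * length ops + 1:]"
| "step_count (Read r p) = [:3:]"
| "step_count (c ;; d) = step_count c + step_count d"
| "step_count (When r c) = [:2:] + step_count c"
| "step_count (For j c) = [:4:] + [:0, 1:] * (step_count c + [:4:])"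

context layout
begin

definition represents :: "nat \<Rightarrow> nat \<Rightarrow> state \<Rightarrow> ('r, 't) env \<Rightarrow> bool" where
  "represents m B s e \<longleftrightarrow>
     (\<forall>r. regs s (reg_num r) = reg e r) \<and> (\<forall>i\<ge>5. i \<notin> range reg_num \<longrightarrow> regs s i = 0) \<and>
     regs s 2 = 1 \<and> regs s 3 = m \<and> regs s 4 = B \<and>
     (\<forall>t i. mem s (cell B t i) = arr e t i) \<and>
     (\<forall>a. a \<notin> range (case_prod (cell B)) \<longrightarrow> mem s a = inp e a) \<and> (\<forall>a\<ge>B. inp e a = 0) \<and>
     buf s = out e"

lemma reg_num_eq [simp]: "reg_num r = reg_num r' \<longleftrightarrow> r = r'"
  by (rule inj_eq[OF inj_reg_num])

lemma reg_num_neq [simp]: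
  "reg_num r \<noteq> 0" "reg_num r \<noteq> Suc 0" "reg_num r \<noteq> 2" "reg_num r \<noteq> 3" "reg_num r \<noteq> 4"
  "0 \<noteq> reg_num r" "Suc 0 \<noteq> reg_num r" "2 \<noteq> reg_num r" "3 \<noteq> reg_num r" "4 \<noteq> reg_num r"
  using reg_num_ge[of r] by auto

lemma cell_eq [simp]: "cell B t i = cell B t' i' \<longleftrightarrow> t = t' \<and> i = i'"
proof
  assume "cell B t i = cell B t' i'"
  then have "(arr_num t + 8 * i) mod 8 = (arr_num t' + 8 * i') mod 8"
    and "(arr_num t + 8 * i) div 8 = (arr_num t' + 8 * i') div 8"
    by (simp_all add: cell_def algebra_simps)
  then show "t = t' \<and> i = i'"
    using arr_num_less[of t] arr_num_less[of t'] inj_arr_num by (simp add: inj_eq)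
qed simp

lemma represents_tick [simp]: "represents m B (tick k s) e = represents m B s e"
  by (simp add: represents_def)

lemma represents_step_Nop [simp]: "represents m B (step Nop s) e = represents m B s e"
  by (simp add: step_def)

lemma represents_set_reg:
  assumes "represents m B s e" "regs t = (regs s)(reg_num r := x)" "mem t = mem s" "buf t = buf s"
  shows "represents m B t (set_reg r x e)"
  using assms by (auto simp: represents_def)

lemma addr_instrs_effect:
  assumes "represents m B s e"
  shows "represents m B (fold step (addr_instrs t i) s) e"
    and "regs (fold step (addr_instrs t i) s) 1 = cell B t (reg e i)"
  using assms by (auto simp: represents_def addr_instrs_def step_def cell_def)

lemma represents_compile_op:
  assumes "represents m B s e"
  shows "represents m B (fold step (compile_op c) s) (eval_op c e)"
proof (cases c)
  case (Get r t i)
  then show ?thesis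
    using addr_instrs_effect[OF assms, of t i]
    by (auto simp: step_def represents_def)
next
  case (Put t i r)
  then show ?thesis
    using addr_instrs_effect[OF assms, of t i]
    by (auto simp: step_def represents_def)
qed (use assms in \<open>auto simp: step_def represents_def absdiff_def\<close>)

lemma represents_compile_ops:
  "represents m B s e \<Longrightarrow>
    represents m B (steps (concat (map compile_op ops)) s) (fold eval_op ops e)"
proof (induction ops arbitrary: s e)
  case (Cons c ops)
  then show ?case
    using Cons.IH[OF represents_compile_op[OF Cons.prems]] by (simp add: steps_def)
qed (simp add: steps_def)

lemma compile_op_no_Emit: "i \<in> set (compile_op c) \<Longrightarrow> small_const i \<and> i \<noteq> Emit"
  using arr_num_less by (cases c) (auto simp: addr_instrs_def)

lemma length_compile_op: "length (compile_op c) \<le> 7"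
  by (cases c) (simp_all add: addr_instrs_def)

lemma length_compile_ops: "length (concat (map compile_op ops)) \<le> 7 * length ops"
  by (induction ops) (simp_all add: length_compile_op add_mono)

lemma loop_code_runs:
  assumes "Reg j \<notin> writes c"
    and body: "\<And>s e. represents m B s e \<Longrightarrow> \<exists>t. runs n d s t \<and> represents m B t (eval m c e)"
    and "k + l = m" "represents m B s (set_reg j k (iterate m j c k e))" "regs s 0 = l"
  shows "\<exists>t. runs (1 + l * (n + 4)) (loop_code j d) s t \<and>
    represents m B t (set_reg j m (iterate m j c m e))"
  using assms(3-)
proof (induction l arbitrary: k s)
  case 0
  then show ?case
    using runs_WhileFalse[of s 0] unfolding loop_code_def by fastforce
next
  case (Suc l)
  let ?s = "tick (word_size (regs s 0)) s" and ?e = "iterate m j c (Suc k) e"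
  let ?next = "[Add (reg_num j) (reg_num j) 2, Sub 0 3 (reg_num j)]"
  obtain s' where body_run: "runs n d ?s s'" "represents m B s' ?e"
    using body[of ?s "set_reg j k (iterate m j c k e)"] Suc.prems(2) by auto
  have "reg ?e j = k" using assms(1) by (simp add: eval_frame)
  then have "regs s' (reg_num j) = k" using body_run(2) by (simp add: represents_def)
  then have "represents m B (steps ?next s') (set_reg j (Suc k) ?e)" "regs (steps ?next s') 0 = l"
    using body_run(2) Suc.prems(1) by (auto simp: represents_def steps_def step_def)
  then obtain t where remaining: "runs (1 + l * (n + 4)) (loop_code j d) (steps ?next s') t"
      "represents m B t (set_reg j m (iterate m j c m e))"
    using Suc.IH[of "Suc k"] Suc.prems(1) by auto
  have "runs (n + 3) (Seq d (instrs ?next)) ?s (steps ?next s')"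
    using runs_Seq[OF body_run(1) runs_instrs[of ?next 3 s']] by simp
  then have "runs (1 + (n + 3) + (1 + l * (n + 4))) (loop_code j d) s t"
    using remaining(1) Suc.prems(3) unfolding loop_code_def by (intro runs_WhileTrue) simp_all
  with remaining(2) show ?case by (auto simp: algebra_simps)
qed

lemma compile_For_runs:
  assumes "Reg j \<notin> writes c"
    and body: "\<And>s e. represents m B s e \<Longrightarrow>
      \<exists>t. runs n (compile c) s t \<and> represents m B t (eval m c e)"
    and "represents m B s e"
  shows "\<exists>t. runs (4 + m * (n + 4)) (compile (For j c)) s t \<and>
    represents m B t (eval m (For j c) e)"
proof -
  let ?init = "[Const (reg_num j) 0, Sub 0 3 (reg_num j)]"
  have "represents m B (steps ?init s) (set_reg j 0 e)" "regs (steps ?init s) 0 = m"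
    using assms(3) by (auto simp: represents_def steps_def step_def)
  then obtain t where "runs (1 + m * (n + 4)) (loop_code j (compile c)) (steps ?init s) t"
      "represents m B t (set_reg j m (iterate m j c m e))"
    using loop_code_runs[OF assms(1) body, of 0 m "steps ?init s" e] by auto
  moreover from this(1) have "runs (4 + m * (n + 4)) (compile (For j c)) s t"
    using runs_Seq[OF runs_instrs[of ?init 3 s]] by fastforce
  ultimately show ?thesis by (auto simp: eval_For)
qed

lemma compile_Read_runs:
  assumes "represents m B s e"
  shows "\<exists>t. runs 3 (compile (Read r p)) s t \<and> represents m B t (eval m (Read r p) e)"
proof -
  let ?a = "reg e p" and ?s = "step (Sub 0 4 (reg_num p)) s"
  let ?s' = "tick (word_size (regs ?s 0)) ?s"
  define i where
    "i = (if regs ?s 0 \<noteq> 0 then Load (reg_num r) (reg_num p) else Const (reg_num r) 0)"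
  have guard: "represents m B ?s' e" "regs ?s 0 = B - ?a" "regs ?s' (reg_num p) = ?a"
    using assms by (auto simp: represents_def step_def)
  have "runs 1 (Do i) ?s' (step i ?s')" by (rule runs_Do) (simp_all add: i_def)
  then have "runs (1 + 1) (Cond 0 (Do (Load (reg_num r) (reg_num p))) (Do (Const (reg_num r) 0)))
      ?s (step i ?s')"
    by (intro runs_Cond) (simp only: i_def if_distrib[of Do])
  then have "runs 3 (compile (Read r p)) s (step i ?s')"
    using runs_Seq[OF runs_Do[of "Sub 0 4 (reg_num p)" s]] by (simp add: numeral_3_eq_3)
  moreover have "regs (step i ?s') = (regs ?s')(reg_num r := inp e ?a)"
  proof (cases "?a < B")
    case True
    then have "?a \<notin> range (case_prod (cell B))" by (auto simp: cell_def)
    then have "mem ?s' ?a = inp e ?a" using guard(1) by (simp add: represents_def)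
    then show ?thesis using True guard(2,3) by (simp add: i_def step_def)
  qed (use guard(1,2) in \<open>simp add: i_def step_def represents_def\<close>)
  then have "represents m B (step i ?s') (eval m (Read r p) e)"
    unfolding eval.simps by (rule represents_set_reg[OF guard(1)]) (simp_all add: i_def step_def)
  ultimately show ?thesis by blast
qed

lemma compile_When_runs:
  assumes body: "\<And>s e. represents m B s e \<Longrightarrow>
      \<exists>t. runs n (compile c) s t \<and> represents m B t (eval m c e)"
    and "represents m B s e"
  shows "\<exists>t. runs (2 + n) (compile (When r c)) s t \<and> represents m B t (eval m (When r c) e)"
proof -
  let ?s = "tick (word_size (regs s (reg_num r))) s"
  let ?c = "if regs s (reg_num r) \<noteq> 0 then compile c else Do Nop"
  have tested: "regs s (reg_num r) = reg e r" using assms(2) by (simp add: represents_def)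
  have "\<exists>t. runs (n + 1) ?c ?s t \<and> represents m B t (eval m (When r c) e)"
  proof (cases "reg e r = 0")
    case True
    have "runs (n + 1) (Do Nop) ?s (step Nop ?s)"
      by (rule runs_mono[OF runs_Do]) simp_all
    with True tested assms(2) show ?thesis by (intro exI[of _ "step Nop ?s"]) simp
  next
    case False
    obtain t where "runs n (compile c) ?s t" "represents m B t (eval m c e)"
      using body[of ?s e] assms(2) by auto
    moreover from this(1) have "runs (n + 1) (compile c) ?s t" by (rule runs_mono) simp
    ultimately show ?thesis using False tested by auto
  qed
  then show ?thesis using runs_Cond by fastforce
qed

lemma compile_runs:
  "well_formed c \<Longrightarrow> represents m B s e \<Longrightarrow>
    \<exists>t. runs (poly (step_count c) m) (compile c) s t \<and> represents m B t (eval m c e)"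
proof (induction c arbitrary: s e)
  case (Block ops)
  let ?is = "concat (map compile_op ops)"
  have "runs (length ?is + 1) (compile (Block ops)) s (steps ?is s)"
    unfolding compile.simps by (rule runs_instrs) (use compile_op_no_Emit in auto)
  then have "runs (7 * length ops + 1) (compile (Block ops)) s (steps ?is s)"
    by (rule runs_mono) (simp add: length_compile_ops)
  with represents_compile_ops[OF Block.prems(2)] show ?case by auto
next
  case (Read r p)
  then show ?case using compile_Read_runs by simp
next
  case (Then c d)
  then obtain t where first: "runs (poly (step_count c) m) (compile c) s t"
      "represents m B t (eval m c e)"
    by fastforce
  with Then obtain u where "runs (poly (step_count d) m) (compile d) t u"
      "represents m B u (eval m d (eval m c e))"
    by fastforce
  with first(1) show ?case by (auto intro: runs_Seq)
next
  case (When r c)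
  then show ?case using compile_When_runs[of m B "poly (step_count c) m" c s e r] by simp
next
  case (For j c)
  then show ?case using compile_For_runs[of j c m B "poly (step_count c) m" s e] by simp
qed

end

section \<open>Numbering and queueing signatures\<close>

definition sig_number :: "bool list \<Rightarrow> nat" where
  "sig_number \<sigma> = fold (\<lambda>b c. c + c + of_bool b) \<sigma> 1"

lemma sig_number_Nil [simp]: "sig_number [] = 1"
  by (simp add: sig_number_def)

lemma sig_number_snoc [simp]: "sig_number (\<sigma> @ [b]) = sig_number \<sigma> + sig_number \<sigma> + of_bool b"
  by (simp add: sig_number_def)

lemma sig_number_inj: "length \<sigma> = length \<tau> \<Longrightarrow> sig_number \<sigma> = sig_number \<tau> \<Longrightarrow> \<sigma> = \<tau>"
proof (induction \<sigma> arbitrary: \<tau> rule: rev_induct)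
  case (snoc b \<sigma>)
  then obtain c \<rho> where \<tau>: "\<tau> = \<rho> @ [c]" "length \<rho> = length \<sigma>"
    by (cases \<tau> rule: rev_cases) auto
  have doubled:
    "sig_number \<sigma> + sig_number \<sigma> + of_bool b = sig_number \<rho> + sig_number \<rho> + of_bool c"
    using snoc.prems(2) by (simp add: \<tau>(1))
  then have "b = c" by (cases b; cases c; simp; presburger)
  with doubled snoc.IH[of \<rho>] \<tau> show ?case by simp
qed simp

definition push :: "'a \<Rightarrow> 'a list \<Rightarrow> 'a list" where
  "push x xs = (if x \<in> set xs then xs else xs @ [x])"

lemma set_push: "set (push x xs) = insert x (set xs)"
  by (auto simp: push_def)

lemma set_fold_push: "set (fold push ys xs) = set xs \<union> set ys"
  by (induction ys arbitrary: xs) (auto simp: set_push)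

lemma fold_push_extends: "\<exists>zs. fold push ys xs = xs @ zs"
proof (induction ys arbitrary: xs)
  case (Cons y ys)
  have "\<exists>zs. push y xs = xs @ zs" by (simp add: push_def)
  with Cons[of "push y xs"] show ?case by auto
qed simp

lemma length_concat_uniform: "\<forall>xs\<in>set xss. length xs = m \<Longrightarrow> length (concat xss) = length xss * m"
  by (induction xss) simp_all

lemma nth_concat_uniform:
  assumes "\<forall>xs\<in>set xss. length xs = m" "h < length xss" "j < m"
  shows "concat xss ! (h * m + j) = xss ! h ! j" and "h * m + j < length (concat xss)"
proof -
  show "concat xss ! (h * m + j) = xss ! h ! j"
    using assms
  proof (induction xss arbitrary: h)
    case (Cons xs xss)
    then show ?case by (cases h) (simp_all add: nth_append)
  qed simp
  have "h * m + j < Suc h * m" using assms(3) by simp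
  also have "\<dots> \<le> length xss * m" using assms(2) by (intro mult_le_mono) simp_all
  finally show "h * m + j < length (concat xss)" by (simp add: length_concat_uniform[OF assms(1)])
qed

section \<open>The enumeration program\<close>

datatype register =
    Edge | Clause | Index | Addr | Bit | Test | Old_label | New_label | Number | Flipped
  | Head | Tail | Pending | Cursor | Unread

datatype array = Source | Target | Rhs | Sig | Label | Value | Visited | Queue

primrec reg_num :: "register \<Rightarrow> nat" where
  "reg_num Edge = 5" | "reg_num Clause = 6" | "reg_num Index = 7" | "reg_num Addr = 8"
| "reg_num Bit = 9" | "reg_num Test = 10" | "reg_num Old_label = 11" | "reg_num New_label = 12"
| "reg_num Number = 13" | "reg_num Flipped = 14" | "reg_num Head = 15" | "reg_num Tail = 16"
| "reg_num Pending = 17" | "reg_num Cursor = 18" | "reg_num Unread = 19"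

primrec arr_num :: "array \<Rightarrow> nat" where
  "arr_num Source = 0" | "arr_num Target = 1" | "arr_num Rhs = 2" | "arr_num Sig = 3"
| "arr_num Label = 4" | "arr_num Value = 5" | "arr_num Visited = 6" | "arr_num Queue = 7"

global_interpretation layout reg_num arr_num
proof
  show "inj reg_num"
  proof (rule injI)
    show "x = y" if "reg_num x = reg_num y" for x y
      using that by (cases x; cases y) simp_all
  qed
  show "inj arr_num"
  proof (rule injI)
    show "x = y" if "arr_num x = arr_num y" for x y
      using that by (cases x; cases y) simp_all
  qed
  show "5 \<le> reg_num r" for r by (cases r) simp_all
  show "arr_num t < 8" for t by (cases t) simp_all
qed

declare reg_num.simps [simp del]

text \<open>
  \<open>Label\<close> and \<open>Value\<close> hold the pair that is merged during a completion. \<open>Visited\<close> is indexed by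
  the numbers of signatures; \<open>Queue\<close> is the concatenation of the signatures found so far, and the
  \<open>Pending\<close> last ones of them, between \<open>Head\<close> and \<open>Tail\<close>, have not been output. On bits,
  \<open>Set_dist\<close> computes the exclusive or.
\<close>

definition violated_ops :: "(register, array) op list" where
  "violated_ops = [Get Addr Source Clause, Get Bit Value Addr, Get Addr Target Clause,
     Get Test Value Addr, Set_dist Bit Bit Test, Get Test Rhs Clause, Set_dist Bit Bit Test]"

definition relabel_code :: "array \<Rightarrow> (register, array) prog" where
  "relabel_code t = Block [Get Addr t Index, Get Test Label Addr, Set_dist Test Test Old_label,
       Set_not Test Test] ;;
     When Test (Block [Put Label Addr New_label, Get Test Value Addr, Set_dist Test Test Bit,
       Put Value Addr Test])"

definition relabel_loop :: "(register, array) prog" where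
  "relabel_loop = For Index (relabel_code Source ;; relabel_code Target)"

definition merge_code :: "(register, array) prog" where
  "merge_code = Block (violated_ops @ [Get Addr Source Clause, Get Old_label Label Addr,
       Get Addr Target Clause, Get New_label Label Addr, Set_dist Test Old_label New_label]) ;;
     When Test relabel_loop"

definition reset_code :: "(register, array) prog" where
  "reset_code = For Clause (Block [Set_bit Bit False,
     Get Addr Source Clause, Put Label Addr Addr, Put Value Addr Bit,
     Get Addr Target Clause, Put Label Addr Addr, Put Value Addr Bit])"

definition merge_selected_code :: "(register, array) prog" where
  "merge_selected_code = For Clause (Block [Get Test Sig Clause] ;; When Test merge_code)"

definition signature_code :: "(register, array) prog" where
  "signature_code = Block [Set_bit Number True] ;;
     For Clause (Block (violated_ops @ [Set_not Bit Bit, Put Sig Clause Bit,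
       Set_sum Number Number Number, Set_sum Number Number Bit]))"

definition completion_code :: "(register, array) prog" where
  "completion_code = reset_code ;; merge_selected_code ;; For Clause merge_code ;; signature_code"

definition enqueue_loop :: "(register, array) prog" where
  "enqueue_loop = For Clause (Block [Get Bit Sig Clause, Put Queue Tail Bit, Incr Tail])"

definition push_code :: "(register, array) prog" where
  "push_code = Block [Get Test Visited Number, Set_not Test Test] ;;
     When Test (Block [Put Visited Number Test, Incr Pending] ;; enqueue_loop)"

definition flip_ops :: "array \<Rightarrow> (register, array) op list" where
  "flip_ops t = [Get Test t Clause, Set_dist Test Test Flipped, Set_not Test Test,
     Set_dist Bit Bit Test]"

definition flip_code :: "(register, array) prog" where
  "flip_code = For Clause (Block ([Set_sum Addr Head Clause, Get Bit Queue Addr] @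
     flip_ops Source @ flip_ops Target @ [Put Sig Clause Bit]))"

definition neighbour_code :: "array \<Rightarrow> (register, array) prog" where
  "neighbour_code t = Block [Get Flipped t Edge] ;; flip_code ;; completion_code ;; push_code"

definition expand_code :: "(register, array) prog" where
  "expand_code = For Edge (neighbour_code Source ;; neighbour_code Target) ;;
     For Clause (Block [Incr Head]) ;; Block [Decr Pending]"

definition negate_ops :: "bool \<Rightarrow> (register, array) op list" where
  "negate_ops neg = (if neg then [Set_not Bit Bit] else [])"

definition output_code :: "bool \<Rightarrow> (register, array) prog" where
  "output_code neg = For Clause (Block ([Set_sum Addr Head Clause, Get Bit Queue Addr] @
     negate_ops neg @ [Append Bit]))"

definition parse_var_code :: "array \<Rightarrow> (register, array) prog" where
  "parse_var_code t = Block [Set_bit Addr False] ;;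
     When Unread (Read Addr Cursor ;; Block [Incr Addr, Incr Cursor, Decr Unread]) ;;
     Block [Put t Clause Addr]"

definition parse_clause_code :: "bool \<Rightarrow> (register, array) prog" where
  "parse_clause_code neg = Read Unread Cursor ;; Block [Incr Cursor] ;;
     parse_var_code Source ;; parse_var_code Target ;;
     Read Bit Cursor ;; Block (Incr Cursor # negate_ops neg @ [Put Rhs Clause Bit])"

definition init_code :: "bool \<Rightarrow> (register, array) prog" where
  "init_code neg = Block [Set_bit Cursor True] ;; For Clause (parse_clause_code neg) ;;
     completion_code ;; push_code"

lemmas merge_defs = violated_ops_def relabel_code_def relabel_loop_def merge_code_def

lemmas completion_defs = merge_defs reset_code_def merge_selected_code_def signature_code_def
  completion_code_def

lemmas code_defs = completion_defs enqueue_loop_def push_code_def flip_ops_def flip_code_def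
  neighbour_code_def expand_code_def negate_ops_def output_code_def parse_var_code_def
  parse_clause_code_def init_code_def

locale bounded_graph = clause_graph m U V E for m and U V :: "nat \<Rightarrow> nat" and E +
  fixes X :: nat
  assumes U_le: "j < m \<Longrightarrow> U j \<le> X" and V_le: "j < m \<Longrightarrow> V j \<le> X" and X_pos: "1 \<le> X"
begin

definition verts_below :: "nat \<Rightarrow> nat set" where
  "verts_below k = U ` {..<k} \<union> V ` {..<k}"

lemma verts_below_0 [simp]: "verts_below 0 = {}"
  and verts_below_m [simp]: "verts_below m = verts"
  and verts_below_Suc: "verts_below (Suc k) = insert (V k) (insert (U k) (verts_below k))"
  by (auto simp: verts_below_def verts_def lessThan_Suc)

definition cells_le :: "(register, array) env \<Rightarrow> bool" where
  "cells_le e \<longleftrightarrow> (\<forall>t i. arr e t i \<le> X)"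

definition graph_env :: "(register, array) env \<Rightarrow> bool" where
  "graph_env e \<longleftrightarrow> cells_le e \<and>
     (\<forall>j<m. arr e Source j = U j \<and> arr e Target j = V j \<and> arr e Rhs j = of_bool (E j))"

lemma cells_le_set_reg [simp]: "cells_le (set_reg r x e) = cells_le e"
  by (simp add: cells_le_def)

lemma cells_le_set_arr [simp]: "cells_le e \<Longrightarrow> x \<le> X \<Longrightarrow> cells_le (set_arr t i x e)"
  by (simp add: cells_le_def)

lemma of_bool_le [simp]: "of_bool b \<le> X"
  using X_pos by (cases b) auto

lemma graph_envD:
  assumes "graph_env e"
  shows "cells_le e" and "j < m \<Longrightarrow> arr e Source j = U j" and "j < m \<Longrightarrow> arr e Target j = V j"
    and "j < m \<Longrightarrow> arr e Rhs j = of_bool (E j)"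
  using assms by (auto simp: graph_env_def)

lemma graph_env_set_reg [simp]: "graph_env (set_reg r x e) = graph_env e"
  by (simp add: graph_env_def)

lemma graph_env_set_arr [simp]:
  "graph_env e \<Longrightarrow> x \<le> X \<Longrightarrow> t \<notin> {Source, Target, Rhs} \<Longrightarrow> graph_env (set_arr t i x e)"
  by (auto simp: graph_env_def)

lemma graph_env_cong: "arr e' = arr e \<Longrightarrow> graph_env e' = graph_env e"
  by (simp add: graph_env_def cells_le_def)

subsection \<open>Completion\<close>

definition merge_env :: "(nat \<Rightarrow> nat) \<times> (nat \<Rightarrow> bool) \<Rightarrow> (register, array) env \<Rightarrow> bool" where
  "merge_env p e \<longleftrightarrow> graph_env e \<and>
     (\<forall>w\<in>verts. arr e Label w = fst p w \<and> arr e Value w = of_bool (snd p w))"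

lemma merge_env_set_reg [simp]: "merge_env p (set_reg r x e) = merge_env p e"
  by (simp add: merge_env_def)

lemma merge_env_cong: "arr e' = arr e \<Longrightarrow> merge_env p e' = merge_env p e"
  by (simp add: merge_env_def graph_env_cong[of e' e])

lemma merge_envD:
  assumes "merge_env p e"
  shows "graph_env e" "cells_le e"
    and "w \<in> verts \<Longrightarrow> arr e Label w = fst p w" "w \<in> verts \<Longrightarrow> arr e Value w = of_bool (snd p w)"
  using assms by (auto simp: merge_env_def graph_env_def)

lemma eval_violated_ops:
  assumes "merge_env p e" "reg e Clause = j" "j < m"
  shows "reg (fold eval_op violated_ops e) Bit = of_bool (\<not> sat (snd p) j)"
  using assms(2,3) merge_envD[OF assms(1)] graph_envD[OF merge_envD(1)[OF assms(1)]]
  by (simp add: violated_ops_def verts_endpoints sat_def)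

definition relabelled :: "nat set \<Rightarrow> (register, array) env \<Rightarrow> (register, array) env \<Rightarrow> bool" where
  "relabelled D e e' \<longleftrightarrow>
     arr e' Label = (\<lambda>w. if w \<in> D \<and> arr e Label w = reg e Old_label
       then reg e New_label else arr e Label w) \<and>
     arr e' Value = (\<lambda>w. if w \<in> D \<and> arr e Label w = reg e Old_label
       then absdiff (arr e Value w) (reg e Bit) else arr e Value w)"

lemma relabelled_insert:
  assumes "relabelled D e e'" "eq_outside (writes relabel_loop) e e'"
    and "reg e Old_label \<noteq> reg e New_label" "t \<noteq> Label" "t \<noteq> Value" "arr e t (reg e' Index) = w"
  shows "relabelled (insert w D) e (eval m (relabel_code t) e')"
proof -
  have "reg e' Old_label = reg e Old_label" "reg e' New_label = reg e New_label"
    "reg e' Bit = reg e Bit" "arr e' t = arr e t"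
    using assms(2,4,5) by (simp_all add: eq_outside_def relabel_loop_def relabel_code_def)
  then show ?thesis
    using assms(1,3-6) by (auto simp: relabelled_def relabel_code_def fun_eq_iff)
qed

lemma eval_relabel_loop:
  assumes "graph_env e" "reg e Old_label \<noteq> reg e New_label"
  shows "relabelled verts e (eval m relabel_loop e)"
proof -
  have "relabelled (verts_below m) e (eval m relabel_loop e)"
    unfolding relabel_loop_def
  proof (rule eval_For_induct[where I = "\<lambda>k e'. relabelled (verts_below k) e e'"])
    fix k e'
    let ?b = "relabel_code Source ;; relabel_code Target"
    assume index: "k < m" "reg e' Index = k" and below: "relabelled (verts_below k) e e'"
      and frame: "eq_outside (writes (For Index ?b)) e e'"
    let ?e = "eval m (relabel_code Source) e'"
    have source: "relabelled (insert (U k) (verts_below k)) e ?e"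
      by (rule relabelled_insert)
        (use below frame assms index graph_envD in \<open>simp_all add: relabel_loop_def\<close>)
    have "eq_outside (writes relabel_loop) e ?e"
      by (rule eq_outside_trans[OF frame eq_outside_eval]) (auto simp: relabel_loop_def)
    moreover have "reg ?e Index = k" using index(2) by (simp add: eval_frame relabel_code_def)
    ultimately show "relabelled (verts_below (Suc k)) e (eval m ?b e')"
      unfolding verts_below_Suc eval.simps
      by (intro relabelled_insert[OF source]) (use assms index graph_envD in simp_all)
  qed (auto simp: relabelled_def)
  then show ?thesis by simp
qed

lemma merge_env_relabelled:
  assumes merging: "merge_env p e"
    and "relabelled verts e e'" "eq_outside (writes relabel_loop) e e'"
    and "\<not> joined p j" "j < m" "reg e Old_label = fst p (U j)" "reg e New_label = fst p (V j)"
    and "reg e Bit = of_bool (\<not> sat (snd p) j)"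
  shows "merge_env (merge j p) e'"
proof -
  have frame: "arr e' t = arr e t" if "t \<noteq> Label" "t \<noteq> Value" for t
    using assms(3) that
    by (cases t) (simp_all add: eq_outside_def relabel_loop_def relabel_code_def)
  have merged: "arr e' Label w = fst (merge j p) w" "arr e' Value w = of_bool (snd (merge j p) w)"
    if "w \<in> verts" for w
    using that assms(2,4-) merge_envD(3,4)[OF merging] by (auto simp: relabelled_def merge_def)
  have "fst p (V j) \<le> X"
    using merge_envD(2,3)[OF merging] verts_endpoints(2)[OF assms(5)]
    unfolding cells_le_def by metis
  have "arr e' t i \<le> X" for t i
  proof (cases "t = Label \<or> t = Value")
    case True
    show ?thesis
    proof (cases "i \<in> verts")
      case False
      then have "arr e' t i = arr e t i" using True assms(2) by (auto simp: relabelled_def)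
      then show ?thesis using merge_envD(2)[OF merging] by (simp add: cells_le_def)
    next
      case vertex: True
      have "arr e' Label i \<le> X"
        using assms(2,7) \<open>fst p (V j) \<le> X\<close> merge_envD(2)[OF merging]
        by (simp add: relabelled_def cells_le_def)
      then show ?thesis using True merged(2)[OF vertex] by auto
    qed
  next
    case False
    then show ?thesis using frame merge_envD(2)[OF merging] by (simp add: cells_le_def)
  qed
  then show ?thesis
    using merged frame merge_envD(1)[OF merging]
    by (simp add: merge_env_def graph_env_def cells_le_def)
qed

lemma eval_merge_code:
  assumes "merge_env p e" "reg e Clause = j" "j < m"
  shows "merge_env (merge j p) (eval m merge_code e)"
proof -
  let ?lookup = "[Get Addr Source Clause, Get Old_label Label Addr, Get Addr Target Clause,
    Get New_label Label Addr, Set_dist Test Old_label New_label]"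
  define e' where "e' = eval m (Block (violated_ops @ ?lookup)) e"
  have labels: "reg e' Old_label = fst p (U j)" "reg e' New_label = fst p (V j)"
    "reg e' Test = absdiff (fst p (U j)) (fst p (V j))" "arr e' = arr e"
    using assms(2,3) merge_envD[OF assms(1)] graph_envD[OF merge_envD(1)[OF assms(1)]]
    by (simp_all add: e'_def violated_ops_def verts_endpoints)
  have violated: "reg e' Bit = of_bool (\<not> sat (snd p) j)"
    using eval_violated_ops[OF assms] by (simp add: e'_def)
  have merging: "merge_env p e'" using assms(1) merge_env_cong[OF labels(4)] by simp
  show ?thesis
  proof (cases "joined p j")
    case True
    then have "eval m merge_code e = e'" "merge j p = p"
      using labels(3) by (simp_all add: merge_code_def e'_def joined_def merge_def)
    with merging show ?thesis by simp
  next
    case False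
    then have "eval m merge_code e = eval m relabel_loop e'"
      using labels(3) by (simp add: merge_code_def e'_def joined_def)
    moreover have "relabelled verts e' (eval m relabel_loop e')"
      using False labels merge_envD(1)[OF merging]
      by (intro eval_relabel_loop) (simp_all add: joined_def)
    ultimately show ?thesis
      using merge_env_relabelled[OF merging _ eq_outside_eval False assms(3) labels(1,2) violated]
      by simp
  qed
qed

lemma eval_reset_code:
  assumes "graph_env e"
  shows "merge_env discrete (eval m reset_code e)"
proof -
  let ?reset = "\<lambda>k e'. graph_env e' \<and>
    (\<forall>w\<in>verts_below k. arr e' Label w = w \<and> arr e' Value w = 0)"
  have "?reset m (eval m reset_code e)"
    unfolding reset_code_def
    by (rule eval_For_induct[where I = ?reset])
      (use assms U_le V_le graph_envD in \<open>auto simp: verts_below_Suc\<close>)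
  then show ?thesis by (simp add: merge_env_def discrete_def)
qed

definition sig_env :: "(nat \<Rightarrow> bool) \<Rightarrow> (register, array) env \<Rightarrow> bool" where
  "sig_env F e \<longleftrightarrow> (\<forall>j<m. arr e Sig j = of_bool (F j))"

lemma eval_merge_selected_code:
  assumes "merge_env p e" "sig_env F e"
  shows "merge_env (fold merge (filter F [0..<m]) p) (eval m merge_selected_code e)"
  unfolding merge_selected_code_def
proof (rule eval_For_induct[where I = "\<lambda>k e'. merge_env (fold merge (filter F [0..<k]) p) e'"])
  let ?b = "Block [Get Test Sig Clause] ;; When Test merge_code"
  fix k e'
  assume index: "k < m" "reg e' Clause = k"
    and merging: "merge_env (fold merge (filter F [0..<k]) p) e'"
    and frame: "eq_outside (writes (For Clause ?b)) e e'"
  have "arr e' Sig = arr e Sig" using frame by (simp add: eq_outside_def merge_defs)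
  then have "arr e' Sig k = of_bool (F k)" using assms(2) index(1) by (simp add: sig_env_def)
  then show "merge_env (fold merge (filter F [0..<Suc k]) p) (eval m ?b e')"
    using index merging by (simp add: eval_merge_code)
qed (use assms in simp_all)

lemma eval_merge_loop:
  assumes "merge_env p e"
  shows "merge_env (fold merge [0..<m] p) (eval m (For Clause merge_code) e)"
  by (rule eval_For_induct[where I = "\<lambda>k e'. merge_env (fold merge [0..<k] p) e'"])
    (use assms eval_merge_code in simp_all)

lemma eval_signature_code:
  assumes "merge_env p e"
  shows "sig_env (sat (snd p)) (eval m signature_code e)"
    and "reg (eval m signature_code e) Number = sig_number (sig (snd p))"
    and "graph_env (eval m signature_code e)"
proof -
  let ?b = "Block (violated_ops @ [Set_not Bit Bit, Put Sig Clause Bit,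
    Set_sum Number Number Number, Set_sum Number Number Bit])"
  let ?built = "\<lambda>k e'. merge_env p e' \<and>
    reg e' Number = sig_number (map (sat (snd p)) [0..<k]) \<and>
    (\<forall>j<k. arr e' Sig j = of_bool (sat (snd p) j))"
  have "?built m (eval m (For Clause ?b) (set_reg Number 1 e))"
  proof (rule eval_For_induct[where I = ?built])
    fix k e'
    assume index: "k < m" "reg e' Clause = k" and built: "?built k e'"
    let ?sat = "of_bool (sat (snd p) k)"
    define e'' where "e'' = fold eval_op violated_ops e'"
    have violated: "reg e'' Bit = of_bool (\<not> sat (snd p) k)"
      unfolding e''_def by (rule eval_violated_ops) (use built index in simp_all)
    have frame: "reg e'' Clause = k" "reg e'' Number = reg e' Number" "arr e'' = arr e'"
      using index(2) by (simp_all add: e''_def violated_ops_def)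
    have "merge_env p e''" using built merge_env_cong[OF frame(3)] by simp
    then have "merge_env p (set_arr Sig k ?sat (set_reg Bit ?sat e''))"
      by (simp add: merge_env_def)
    then show "?built (Suc k) (eval m ?b e')"
      using violated frame built
      by (simp add: e''_def[symmetric] less_Suc_eq del: of_bool_eq)
  qed (use assms in simp_all)
  then show "sig_env (sat (snd p)) (eval m signature_code e)"
    and "reg (eval m signature_code e) Number = sig_number (sig (snd p))"
    and "graph_env (eval m signature_code e)"
    by (simp_all add: signature_code_def sig_env_def sig_def merge_env_def)
qed

lemma eval_completion_code:
  assumes "graph_env e" "sig_env F e"
  shows "sig_env ((!) (completion F)) (eval m completion_code e)"
    and "reg (eval m completion_code e) Number = sig_number (completion F)"
    and "graph_env (eval m completion_code e)"
proof -
  define e' where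
    "e' = eval m (For Clause merge_code) (eval m merge_selected_code (eval m reset_code e))"
  have "sig_env F (eval m reset_code e)"
    using assms(2) by (simp add: sig_env_def eval_frame reset_code_def)
  then have "merge_env (merge_all F) e'"
    unfolding e'_def merge_all_def
    by (intro eval_merge_loop eval_merge_selected_code eval_reset_code assms(1))
  moreover have "eval m completion_code e = eval m signature_code e'"
    by (simp add: completion_code_def e'_def)
  ultimately show "sig_env ((!) (completion F)) (eval m completion_code e)"
    and "reg (eval m completion_code e) Number = sig_number (completion F)"
    and "graph_env (eval m completion_code e)"
    using eval_signature_code by (simp_all add: completion_def sig_env_def)
qed

subsection \<open>Breadth-first search\<close>

definition queue_env :: "bool list list \<Rightarrow> (register, array) env \<Rightarrow> bool" where
  "queue_env Q e \<longleftrightarrow> reg e Tail = length (concat Q) \<and>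
     (\<forall>i<length (concat Q). arr e Queue i = of_bool (concat Q ! i))"

definition search_env :: "bool list list \<Rightarrow> nat \<Rightarrow> (register, array) env \<Rightarrow> bool" where
  "search_env Q h e \<longleftrightarrow> distinct Q \<and> set Q \<subseteq> maximal_sigs \<and> graph_env e \<and> queue_env Q e \<and>
     reg e Head = h * m \<and> reg e Pending + h = length Q \<and>
     (\<forall>c. arr e Visited c = of_bool (c \<in> sig_number ` set Q))"

lemma search_envD:
  assumes "search_env Q h e"
  shows "distinct Q" "set Q \<subseteq> maximal_sigs" "graph_env e" "queue_env Q e"
    "reg e Head = h * m" "reg e Pending + h = length Q"
    "arr e Visited c = of_bool (c \<in> sig_number ` set Q)"
  using assms by (simp_all add: search_env_def)

lemma search_env_cong:
  assumes "\<And>r. r \<in> {Head, Tail, Pending} \<Longrightarrow> reg e' r = reg e r" "arr e' = arr e"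
  shows "search_env Q h e' = search_env Q h e"
  using assms graph_env_cong[OF assms(2)] by (simp add: search_env_def queue_env_def)

lemma search_env_set_reg [simp]:
  "r \<notin> {Head, Tail, Pending} \<Longrightarrow> search_env Q h (set_reg r x e) = search_env Q h e"
  by (rule search_env_cong) auto

lemma search_env_eval:
  assumes "search_env Q h e" "graph_env (eval m c e)"
    and "writes c \<inter> {Reg Head, Reg Tail, Reg Pending, Arr Queue, Arr Visited} = {}"
  shows "search_env Q h (eval m c e)"
  using assms by (auto simp: search_env_def queue_env_def eval_frame)

lemma search_env_queue:
  assumes "search_env Q h e" "h < length Q" "j < m"
  shows "arr e Queue (h * m + j) = of_bool (Q ! h ! j)"
proof -
  have "\<forall>\<sigma>\<in>set Q. length \<sigma> = m"
    using search_envD(2)[OF assms(1)] length_maximal_sigs by blast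
  from nth_concat_uniform[OF this assms(2,3)] show ?thesis
    using search_envD(4)[OF assms(1)] by (simp add: queue_env_def)
qed

lemma eval_enqueue_loop:
  assumes "graph_env e" "queue_env Q e" "sig_env ((!) \<sigma>) e" "length \<sigma> = m"
  shows "graph_env (eval m enqueue_loop e)" and "queue_env (Q @ [\<sigma>]) (eval m enqueue_loop e)"
proof -
  let ?b = "Block [Get Bit Sig Clause, Put Queue Tail Bit, Incr Tail]"
  let ?copied = "\<lambda>k e'. graph_env e' \<and> reg e' Tail = length (concat Q) + k \<and>
    (\<forall>i<length (concat Q) + k. arr e' Queue i = of_bool ((concat Q @ \<sigma>) ! i))"
  have "?copied m (eval m enqueue_loop e)"
    unfolding enqueue_loop_def
  proof (rule eval_For_induct[where I = ?copied])
    show "?copied 0 e" using assms(1,2) by (simp add: queue_env_def nth_append)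
    fix k e'
    assume index: "k < m" "reg e' Clause = k" and copied: "?copied k e'"
      and frame: "eq_outside (writes (For Clause ?b)) e e'"
    have "arr e' Sig k = of_bool (\<sigma> ! k)"
      using frame assms(3) index(1) by (simp add: eq_outside_def sig_env_def)
    then show "?copied (Suc k) (eval m ?b e')"
      using index copied by (auto simp: less_Suc_eq nth_append simp del: of_bool_eq)
  qed simp
  with assms(4)
  show "graph_env (eval m enqueue_loop e)" "queue_env (Q @ [\<sigma>]) (eval m enqueue_loop e)"
    by (simp_all add: queue_env_def)
qed

lemma eval_push_code:
  assumes search: "search_env Q h e" and "\<sigma> \<in> maximal_sigs"
    and stored: "sig_env ((!) \<sigma>) e" "reg e Number = sig_number \<sigma>"
  shows "search_env (push \<sigma> Q) h (eval m push_code e)"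
proof -
  have "sig_number \<sigma> \<in> sig_number ` set Q \<longleftrightarrow> \<sigma> \<in> set Q"
    using search_envD(2)[OF search] assms(2) sig_number_inj length_maximal_sigs
    unfolding image_iff by (metis subsetD)
  then have visited: "arr e Visited (sig_number \<sigma>) = of_bool (\<sigma> \<in> set Q)"
    using search_envD(7)[OF search] by simp
  show ?thesis
  proof (cases "\<sigma> \<in> set Q")
    case True
    then have "eval m push_code e = set_reg Test 0 (set_reg Test 1 e)"
      using stored(2) visited by (simp add: push_code_def)
    then show ?thesis using search True by (simp add: push_def)
  next
    case False
    define e' where "e' = set_reg Pending (Suc (reg e Pending))
      (set_arr Visited (sig_number \<sigma>) 1 (set_reg Test 1 (set_reg Test 0 e)))"
    have unfolded: "eval m push_code e = eval m enqueue_loop e'"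
      using False stored(2) visited by (simp add: push_code_def e'_def)
    have "graph_env e'" "queue_env Q e'" "sig_env ((!) \<sigma>) e'"
      using search_envD(3,4)[OF search] stored(1) X_pos
      by (simp_all add: e'_def queue_env_def sig_env_def)
    note enqueued = eval_enqueue_loop[OF this length_maximal_sigs[OF assms(2)]]
    have "reg (eval m enqueue_loop e') Head = h * m"
        "reg (eval m enqueue_loop e') Pending + h = Suc (length Q)"
        "arr (eval m enqueue_loop e') Visited c = of_bool (c \<in> sig_number ` set (Q @ [\<sigma>]))" for c
      using search_envD(5,6,7)[OF search] by (simp_all add: eval_frame enqueue_loop_def e'_def)
    with enqueued show ?thesis
      using False assms(2) search_envD(1,2)[OF search]
      by (simp add: search_env_def unfolded push_def)
  qed
qed

lemma eval_complete_and_push: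
  assumes "search_env Q h e" "sig_env F e"
  shows "search_env (push (completion F) Q) h (eval m (completion_code ;; push_code) e)"
proof -
  note completed = eval_completion_code[OF search_envD(3)[OF assms(1)] assms(2)]
  have "search_env Q h (eval m completion_code e)"
    by (rule search_env_eval[OF assms(1) completed(3)]) (auto simp: completion_defs)
  from eval_push_code[OF this completion_maximal completed(1,2)] show ?thesis by simp
qed

lemma eval_flip_ops:
  assumes "reg e Bit = of_bool b"
  shows "reg (fold eval_op (flip_ops t) e) Bit =
      of_bool (b \<noteq> (arr e t (reg e Clause) = reg e Flipped))"
    and "r \<noteq> Bit \<Longrightarrow> r \<noteq> Test \<Longrightarrow> reg (fold eval_op (flip_ops t) e) r = reg e r"
    and "arr (fold eval_op (flip_ops t) e) = arr e"
  using assms absdiff_of_bool[of b True] absdiff_of_bool[of b False]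
  by (auto simp: flip_ops_def simp del: absdiff_of_bool)

lemma eval_flip_both_ends:
  assumes "graph_env e" "reg e Clause = k" "k < m" "reg e Flipped = v"
    and "reg e Bit = of_bool (\<sigma> ! k)"
  defines "e' \<equiv> fold eval_op (flip_ops Source @ flip_ops Target) e"
  shows "reg e' Bit = of_bool (flip_sig v \<sigma> k)" and "reg e' Clause = k" and "arr e' = arr e"
proof -
  define e'' where "e'' = fold eval_op (flip_ops Source) e"
  have target: "e' = fold eval_op (flip_ops Target) e''" by (simp add: e'_def e''_def)
  have source: "reg e'' Bit = of_bool (\<sigma> ! k \<noteq> (U k = v))" "reg e'' Clause = k"
      "reg e'' Flipped = v" "arr e'' = arr e"
    using eval_flip_ops[where t = Source, OF assms(5)] assms(1-4) graph_envD(2)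
    by (simp_all add: e''_def)
  show "reg e' Bit = of_bool (flip_sig v \<sigma> k)" "reg e' Clause = k" "arr e' = arr e"
    using eval_flip_ops[where t = Target, OF source(1)] source assms(1,3) graph_envD(3)
    by (simp_all add: target flip_sig_def)
qed

lemma eval_flip_code:
  assumes search: "search_env Q h e" "h < length Q" and "reg e Flipped = v"
  shows "sig_env (flip_sig v (Q ! h)) (eval m flip_code e)" and "graph_env (eval m flip_code e)"
proof -
  let ?load = "[Set_sum Addr Head Clause, Get Bit Queue Addr]"
  let ?b = "Block (?load @ flip_ops Source @ flip_ops Target @ [Put Sig Clause Bit])"
  let ?flipped = "\<lambda>k e'. graph_env e' \<and> (\<forall>j<k. arr e' Sig j = of_bool (flip_sig v (Q ! h) j))"
  have "?flipped m (eval m flip_code e)"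
    unfolding flip_code_def
  proof (rule eval_For_induct[where I = ?flipped])
    fix k e'
    assume index: "k < m" "reg e' Clause = k" and flipped: "?flipped k e'"
      and "eq_outside (writes (For Clause ?b)) e e'"
    then have frame: "reg e' Head = h * m" "reg e' Flipped = v" "arr e' Queue = arr e Queue"
      using search_envD(5)[OF search(1)] assms(3) by (simp_all add: eq_outside_def flip_ops_def)
    let ?e = "fold eval_op ?load e'"
    let ?e' = "fold eval_op (flip_ops Source @ flip_ops Target) ?e"
    have "graph_env ?e" "reg ?e Clause = k" "reg ?e Flipped = v"
      "reg ?e Bit = of_bool (Q ! h ! k)"
      using index frame flipped search_env_queue[OF search index(1)] by simp_all
    note both_ends = eval_flip_both_ends[OF this(1,2) index(1) this(3,4)]
    have "eval m ?b e' = set_arr Sig k (of_bool (flip_sig v (Q ! h) k)) ?e'"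
      using both_ends by simp
    moreover have "graph_env ?e'" using graph_env_cong[OF both_ends(3)] flipped by simp
    ultimately show "?flipped (Suc k) (eval m ?b e')"
      using both_ends(3) flipped by (simp add: less_Suc_eq del: of_bool_eq)
  qed (use search_envD(3)[OF search(1)] in simp_all)
  then show "sig_env (flip_sig v (Q ! h)) (eval m flip_code e)" "graph_env (eval m flip_code e)"
    by (simp_all add: sig_env_def)
qed

lemma eval_neighbour_code:
  assumes search: "search_env Q h e" "h < length Q" and "arr e t (reg e Edge) = v"
  shows "search_env (push (completion (flip_sig v (Q ! h))) Q) h (eval m (neighbour_code t) e)"
proof -
  let ?e = "set_reg Flipped v e"
  have flip: "search_env Q h ?e" "reg ?e Flipped = v" using search(1) by simp_all
  note flipped = eval_flip_code[OF flip(1) search(2) flip(2)]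
  have "search_env Q h (eval m flip_code ?e)"
    by (rule search_env_eval[OF flip(1) flipped(2)]) (auto simp: flip_code_def flip_ops_def)
  from eval_complete_and_push[OF this flipped(1)] show ?thesis
    using assms(3) by (simp add: neighbour_code_def)
qed

definition successors :: "nat \<Rightarrow> bool list \<Rightarrow> bool list list" where
  "successors k \<sigma> =
     concat (map (\<lambda>j. [completion (flip_sig (U j) \<sigma>), completion (flip_sig (V j) \<sigma>)]) [0..<k])"

lemma set_successors: "set (successors m \<sigma>) = (\<lambda>v. completion (flip_sig v \<sigma>)) ` verts"
  by (auto simp: successors_def verts_def)

lemma eval_neighbours_loop:
  assumes "search_env Q h e" "h < length Q"
  shows "search_env (fold push (successors m (Q ! h)) Q) h
    (eval m (For Edge (neighbour_code Source ;; neighbour_code Target)) e)"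
proof -
  let ?b = "neighbour_code Source ;; neighbour_code Target"
  let ?pushed = "\<lambda>k. search_env (fold push (successors k (Q ! h)) Q) h"
  show ?thesis
  proof (rule eval_For_induct[where I = ?pushed])
    fix k e'
    let ?Q = "fold push (successors k (Q ! h)) Q" and ?e = "eval m (neighbour_code Source) e'"
    let ?Q' = "push (completion (flip_sig (U k) (Q ! h))) ?Q"
    assume index: "k < m" "reg e' Edge = k" and pushed: "?pushed k e'"
    obtain zs where "?Q = Q @ zs" using fold_push_extends by blast
    then have head: "h < length ?Q" "?Q ! h = Q ! h"
      using assms(2) by (simp_all add: nth_append)
    then have head': "h < length ?Q'" "?Q' ! h = Q ! h"
      by (simp_all add: push_def nth_append)
    have "arr e' Source k = U k" using graph_envD(2)[OF search_envD(3)[OF pushed] index(1)] .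
    then have source: "search_env ?Q' h ?e"
      using eval_neighbour_code[OF pushed head(1), of Source "U k"] index(2) head(2) by simp
    have "arr ?e Target k = V k" using graph_envD(3)[OF search_envD(3)[OF source] index(1)] .
    moreover have "reg ?e Edge = k" using index(2) by (simp add: eval_frame code_defs)
    ultimately have "search_env (push (completion (flip_sig (V k) (Q ! h))) ?Q') h (eval m ?b e')"
      using eval_neighbour_code[OF source head'(1), of Target "V k"] head'(2) by simp
    then show "?pushed (Suc k) (eval m ?b e')" by (simp add: successors_def)
  qed (use assms in \<open>simp_all add: successors_def\<close>)
qed

lemma eval_expand_code:
  assumes "search_env Q h e" "h < length Q"
  shows "search_env (fold push (successors m (Q ! h)) Q) (Suc h) (eval m expand_code e)"
proof -
  let ?Q = "fold push (successors m (Q ! h)) Q"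
  define e' where "e' = eval m (For Edge (neighbour_code Source ;; neighbour_code Target)) e"
  define e'' where "e'' = eval m (For Clause (Block [Incr Head])) e'"
  have pushed: "search_env ?Q h e'" unfolding e'_def by (rule eval_neighbours_loop[OF assms])
  have "reg e'' Head = h * m + m"
    unfolding e''_def by (rule eval_For_induct[where I = "\<lambda>k e'. reg e' Head = h * m + k"])
      (use search_envD(5)[OF pushed] in simp_all)
  moreover have frame: "arr e'' = arr e'" "reg e'' Tail = reg e' Tail"
      "reg e'' Pending = reg e' Pending"
    by (auto simp: e''_def eval_frame)
  moreover obtain zs where "?Q = Q @ zs" using fold_push_extends by blast
  then have "Suc h \<le> length ?Q" using assms(2) by simp
  ultimately have "search_env ?Q (Suc h) (set_reg Pending (reg e'' Pending - 1) e'')"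
    using pushed graph_env_cong[OF frame(1)] by (auto simp: search_env_def queue_env_def)
  then show ?thesis by (simp add: expand_code_def e''_def e'_def)
qed

lemma eval_output_code:
  assumes search: "search_env Q h e" "h < length Q" and "out e = []"
  shows "out (eval m (output_code neg) e) = map (\<lambda>b. of_bool (b \<noteq> neg)) (Q ! h)"
    and "search_env Q h (eval m (output_code neg) e)"
proof -
  let ?b = "Block ([Set_sum Addr Head Clause, Get Bit Queue Addr] @
    negate_ops neg @ [Append Bit])"
  let ?bits = "map (\<lambda>b. of_bool (b \<noteq> neg)) :: _ \<Rightarrow> nat list"
  have length: "length (Q ! h) = m"
    using search_envD(2)[OF search(1)] search(2) length_maximal_sigs by (meson nth_mem subsetD)
  have "out (eval m (output_code neg) e) = ?bits (take m (Q ! h))"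
    unfolding output_code_def
  proof (rule eval_For_induct[where I = "\<lambda>k e'. out e' = ?bits (take k (Q ! h))"])
    fix k e'
    assume index: "k < m" "reg e' Clause = k" and written: "out e' = ?bits (take k (Q ! h))"
      and frame: "eq_outside (writes (For Clause ?b)) e e'"
    have "reg e' Head = h * m" "arr e' Queue (h * m + k) = of_bool (Q ! h ! k)"
      using frame search_envD(5)[OF search(1)] search_env_queue[OF search index(1)]
      by (cases neg; auto simp: eq_outside_def negate_ops_def)+
    then show "out (eval m ?b e') = ?bits (take (Suc k) (Q ! h))"
      using index written length
      by (cases neg) (auto simp: take_Suc_conv_app_nth negate_ops_def)
  qed (use assms(3) in simp_all)
  then show "out (eval m (output_code neg) e) = ?bits (Q ! h)" by (simp add: length)
  have "arr (eval m (output_code neg) e) = arr e"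
    by (auto simp: eval_frame output_code_def negate_ops_def)
  then have "graph_env (eval m (output_code neg) e)"
    using graph_env_cong search_envD(3)[OF search(1)] by blast
  then show "search_env Q h (eval m (output_code neg) e)"
    by (rule search_env_eval[OF search(1)]) (auto simp: output_code_def negate_ops_def)
qed

end

section \<open>Formulas as graphs\<close>

text \<open>
  Variable \<open>x\<close> becomes the vertex \<open>x + 1\<close>, and the vertex \<open>0\<close> stands for the constant \<open>0\<close>; a
  clause with fewer than two variables is an edge to \<open>0\<close>.
\<close>

definition edge_u :: "xor_cnf \<Rightarrow> nat \<Rightarrow> nat" where
  "edge_u \<phi> j = (case fst (\<phi> ! j) of [] \<Rightarrow> 0 | x # _ \<Rightarrow> Suc x)"

definition edge_v :: "xor_cnf \<Rightarrow> nat \<Rightarrow> nat" where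
  "edge_v \<phi> j = (case fst (\<phi> ! j) of x # y # _ \<Rightarrow> Suc y | _ \<Rightarrow> 0)"

definition edge_rhs :: "bool \<Rightarrow> xor_cnf \<Rightarrow> nat \<Rightarrow> bool" where
  "edge_rhs neg \<phi> j \<longleftrightarrow> (snd (\<phi> ! j) = 1) \<noteq> neg"

lemma two_xor_cases:
  assumes "two_xor_cnf \<phi>" "j < length \<phi>"
  obtains \<epsilon> where "\<phi> ! j = ([], \<epsilon>)"
    | x \<epsilon> where "\<phi> ! j = ([x], \<epsilon>)"
    | x y \<epsilon> where "\<phi> ! j = ([x, y], \<epsilon>)"
proof -
  obtain vs \<epsilon> where clause: "\<phi> ! j = (vs, \<epsilon>)" by fastforce
  have "length vs \<le> 2"
    using assms nth_mem[OF assms(2)] clause by (fastforce simp: two_xor_cnf_def)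
  then consider "vs = []" | x where "vs = [x]" | x y where "vs = [x, y]"
    by (cases vs; cases "tl vs"; cases "tl (tl vs)") auto
  then show ?thesis using clause that by cases auto
qed

definition clause_offset :: "xor_cnf \<Rightarrow> nat \<Rightarrow> nat" where
  "clause_offset \<phi> k = Suc (length (concat (map encode_clause (take k \<phi>))))"

lemma clause_offset_0 [simp]: "clause_offset \<phi> 0 = 1"
  by (simp add: clause_offset_def)

lemma clause_offset_Suc:
  "k < length \<phi> \<Longrightarrow> clause_offset \<phi> (Suc k) = clause_offset \<phi> k + length (encode_clause (\<phi> ! k))"
  by (simp add: clause_offset_def take_Suc_conv_app_nth)

lemma encode_cnf_nth:
  assumes "k < length \<phi>" "i < length (encode_clause (\<phi> ! k))"
  shows "encode_cnf \<phi> ! (clause_offset \<phi> k + i) = encode_clause (\<phi> ! k) ! i"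
    and "clause_offset \<phi> k + i < length (encode_cnf \<phi>)"
proof -
  have "concat (map encode_clause \<phi>) = concat (map encode_clause (take k \<phi>)) @
      encode_clause (\<phi> ! k) @ concat (map encode_clause (drop (Suc k) \<phi>))"
    by (metis assms(1) concat.simps(2) concat_append id_take_nth_drop list.simps(9) map_append)
  then show "encode_cnf \<phi> ! (clause_offset \<phi> k + i) = encode_clause (\<phi> ! k) ! i"
    and "clause_offset \<phi> k + i < length (encode_cnf \<phi>)"
    using assms(2) by (simp_all add: encode_cnf_def clause_offset_def nth_append)
qed

locale formula =
  fixes \<phi> :: xor_cnf and neg :: bool and X :: nat
  assumes two_xor: "two_xor_cnf \<phi>" and input_less: "x \<in> set (encode_cnf \<phi>) \<Longrightarrow> x < X"
begin

lemma clause_vars_less: "j < length \<phi> \<Longrightarrow> x \<in> set (fst (\<phi> ! j)) \<Longrightarrow> x < X"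
  by (rule input_less) (force simp: encode_cnf_def encode_clause_def)

end

sublocale formula \<subseteq> bounded_graph "length \<phi>" "edge_u \<phi>" "edge_v \<phi>" "edge_rhs neg \<phi>" X
proof
  show "1 \<le> X" using input_less[of "length \<phi>"] by (simp add: encode_cnf_def)
  fix j assume "j < length \<phi>"
  then show "edge_u \<phi> j \<le> X" "edge_v \<phi> j \<le> X"
    using clause_vars_less[of j]
    by (auto simp: edge_u_def edge_v_def Suc_le_eq split: list.splits)
qed

context formula
begin

subsection \<open>Reading the formula\<close>

definition input_env :: "(register, array) env \<Rightarrow> bool" where
  "input_env e \<longleftrightarrow> (\<forall>i<length (encode_cnf \<phi>). inp e i = encode_cnf \<phi> ! i)"

lemma eval_parse_clause_code:
  assumes index: "k < length \<phi>" "reg e Clause = k"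
    and input: "reg e Cursor = clause_offset \<phi> k" "input_env e"
  defines "e' \<equiv> eval (length \<phi>) (parse_clause_code neg) e"
  shows "reg e' Cursor = clause_offset \<phi> (Suc k)"
    and "arr e' Source = (arr e Source)(k := edge_u \<phi> k)"
    and "arr e' Target = (arr e Target)(k := edge_v \<phi> k)"
    and "arr e' Rhs = (arr e Rhs)(k := of_bool (edge_rhs neg \<phi> k))"
proof -
  have read: "inp e (clause_offset \<phi> k + i) = encode_clause (\<phi> ! k) ! i"
    if "i < length (encode_clause (\<phi> ! k))" for i
    using encode_cnf_nth[OF index(1) that] input(2) by (simp add: input_env_def)
  note cells = read[of 0] read[of "Suc 0"] read[of "Suc (Suc 0)"] read[of "Suc (Suc (Suc 0))"]
  have "reg e' Cursor = clause_offset \<phi> (Suc k) \<and>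
    arr e' Source = (arr e Source)(k := edge_u \<phi> k) \<and>
    arr e' Target = (arr e Target)(k := edge_v \<phi> k) \<and>
    arr e' Rhs = (arr e Rhs)(k := of_bool (edge_rhs neg \<phi> k))"
    using two_xor index(1)
    by (cases rule: two_xor_cases)
      (use cells index input(1) in \<open>auto simp: e'_def parse_clause_code_def parse_var_code_def
        negate_ops_def clause_offset_Suc encode_clause_def edge_u_def edge_v_def edge_rhs_def\<close>)
  then show "reg e' Cursor = clause_offset \<phi> (Suc k)"
    "arr e' Source = (arr e Source)(k := edge_u \<phi> k)"
    "arr e' Target = (arr e Target)(k := edge_v \<phi> k)"
    "arr e' Rhs = (arr e Rhs)(k := of_bool (edge_rhs neg \<phi> k))"
    by simp_all
qed

lemma writes_parse_clause_code:
  "writes (parse_clause_code neg) =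
    {Reg Unread, Reg Cursor, Reg Addr, Reg Bit, Arr Source, Arr Target, Arr Rhs}"
  by (auto simp: parse_clause_code_def parse_var_code_def negate_ops_def)

lemma eval_parse_loop:
  assumes "input_env e" "cells_le e" "reg e Cursor = 1"
  shows "graph_env (eval (length \<phi>) (For Clause (parse_clause_code neg)) e)"
proof -
  let ?parsed = "\<lambda>k e'. reg e' Cursor = clause_offset \<phi> k \<and> cells_le e' \<and>
    (\<forall>j<k. arr e' Source j = edge_u \<phi> j \<and> arr e' Target j = edge_v \<phi> j \<and>
      arr e' Rhs j = of_bool (edge_rhs neg \<phi> j))"
  have "?parsed (length \<phi>) (eval (length \<phi>) (For Clause (parse_clause_code neg)) e)"
  proof (rule eval_For_induct[where I = ?parsed])
    fix k e'
    let ?e = "eval (length \<phi>) (parse_clause_code neg) e'"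
    assume index: "k < length \<phi>" "reg e' Clause = k" and parsed: "?parsed k e'"
      and frame: "eq_outside (writes (For Clause (parse_clause_code neg))) e e'"
    have "input_env e'" using frame assms(1) by (simp add: eq_outside_def input_env_def)
    note clause = eval_parse_clause_code[OF index _ this]
    have "arr ?e t = arr e' t" if "t \<notin> {Source, Target, Rhs}" for t
      using that by (simp add: eval_frame writes_parse_clause_code)
    then have "arr ?e t i \<le> X" for t i
      using parsed clause U_le[OF index(1)] V_le[OF index(1)]
      by (cases "t \<in> {Source, Target, Rhs}") (auto simp: cells_le_def)
    then show "?parsed (Suc k) ?e"
      using parsed clause by (simp add: less_Suc_eq cells_le_def)
  qed (use assms in simp_all)
  then show ?thesis by (simp add: graph_env_def)
qed

lemma eval_init_code:
  assumes "input_env e" and zero: "\<And>t i. arr e t i = 0" "\<And>r. reg e r = 0"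
  shows "search_env [completion (\<lambda>_. False)] 0 (eval (length \<phi>) (init_code neg) e)"
proof -
  let ?e = "set_reg Cursor 1 e"
  define e' where "e' = eval (length \<phi>) (For Clause (parse_clause_code neg)) ?e"
  have "graph_env e'"
    unfolding e'_def
    by (rule eval_parse_loop) (use assms in \<open>simp_all add: input_env_def cells_le_def\<close>)
  moreover have "arr e' t = arr ?e t" if "t \<notin> {Source, Target, Rhs}" for t
    unfolding e'_def using that by (simp add: eval_frame writes_parse_clause_code)
  moreover have "reg e' r = reg ?e r" if "r \<in> {Head, Tail, Pending}" for r
    unfolding e'_def using that by (auto simp: eval_frame writes_parse_clause_code)
  ultimately have "search_env [] 0 e'" "sig_env (\<lambda>_. False) e'"
    using zero by (simp_all add: search_env_def queue_env_def sig_env_def)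
  from eval_complete_and_push[OF this] show ?thesis
    by (simp add: init_code_def e'_def push_def)
qed

subsection \<open>Signatures of the formula\<close>

definition out_bits :: "bool list \<Rightarrow> nat list" where
  "out_bits = map (\<lambda>b. of_bool (b \<noteq> neg))"

definition vertex_values :: "(nat \<Rightarrow> bit) \<Rightarrow> nat \<Rightarrow> bool" where
  "vertex_values a = case_nat False (\<lambda>x. a x = 1)"

definition var_values :: "(nat \<Rightarrow> bool) \<Rightarrow> nat \<Rightarrow> bit" where
  "var_values b x = of_bool (b (Suc x) \<noteq> b 0)"

lemma holds_iff_sat:
  assumes "j < length \<phi>"
  shows "holds a (\<phi> ! j) \<longleftrightarrow> sat (vertex_values a) j \<noteq> neg"
  using two_xor assms
proof (cases rule: two_xor_cases)
  note defs = holds_def sat_def edge_u_def edge_v_def edge_rhs_def vertex_values_def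
  show ?thesis if "\<phi> ! j = ([], \<epsilon>)" for \<epsilon>
    using that by (cases \<epsilon>) (simp_all add: defs)
  show ?thesis if "\<phi> ! j = ([x], \<epsilon>)" for x \<epsilon>
    using that by (cases \<epsilon>; cases "a x") (simp_all add: defs)
  show ?thesis if "\<phi> ! j = ([x, y], \<epsilon>)" for x y \<epsilon>
    using that by (cases \<epsilon>; cases "a x"; cases "a y") (simp_all add: defs)
qed

lemma sat_vertex_values_var_values: "sat (vertex_values (var_values b)) j = sat b j"
proof -
  have "vertex_values (var_values b) v \<longleftrightarrow> b v \<noteq> b 0" for v
    by (cases v) (simp_all add: vertex_values_def var_values_def)
  then show ?thesis by (auto simp: sat_def)
qed

lemma signature_eq: "signature \<phi> a = out_bits (sig (vertex_values a))"
  by (rule nth_equalityI) (simp_all add: signature_def out_bits_def holds_iff_sat)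

lemma signatures_eq: "signatures \<phi> = range (\<lambda>b. out_bits (sig b))"
proof -
  have "out_bits (sig b) = signature \<phi> (var_values b)" for b
    by (simp add: signature_eq sig_def sat_vertex_values_var_values[abs_def])
  then show ?thesis unfolding signatures_def signature_eq by auto
qed

lemma inj_out_bits: "inj out_bits"
  unfolding out_bits_def by (rule inj_mapI) (auto simp: inj_def)

lemma maximal_iff_out_bits:
  "maximal a \<longleftrightarrow>
    (\<forall>b. (\<forall>j<length \<phi>. sat a j \<longrightarrow> sat b j) \<longrightarrow> out_bits (sig b) = out_bits (sig a))"
  unfolding maximal_def inj_eq[OF inj_out_bits] sig_eq_iff by blast

lemma bitwise_le_out_bits:
  "bitwise_le (out_bits (sig a)) (out_bits (sig b)) \<longleftrightarrow>
    (\<forall>j<length \<phi>. if neg then sat b j \<longrightarrow> sat a j else sat a j \<longrightarrow> sat b j)"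
  by (auto simp: bitwise_le_def out_bits_def list_all2_conv_all_nth)

lemma out_bits_maximal_sigs:
  "out_bits ` maximal_sigs = (if neg then minimal_signatures \<phi> else maximal_signatures \<phi>)"
proof (cases neg)
  case True
  have below: "bitwise_le (out_bits (sig b)) (out_bits (sig a)) \<longleftrightarrow>
      (\<forall>j<length \<phi>. sat a j \<longrightarrow> sat b j)" for a b
    unfolding bitwise_le_out_bits if_P[OF True] ..
  have "out_bits ` maximal_sigs = minimal_signatures \<phi>"
    unfolding maximal_sigs_def minimal_signatures_def signatures_eq maximal_iff_out_bits
      below[symmetric]
    by blast
  then show ?thesis using True by simp
next
  case False
  have above: "bitwise_le (out_bits (sig a)) (out_bits (sig b)) \<longleftrightarrow>
      (\<forall>j<length \<phi>. sat a j \<longrightarrow> sat b j)" for a b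
    unfolding bitwise_le_out_bits if_not_P[OF False] ..
  have "out_bits ` maximal_sigs = maximal_signatures \<phi>"
    unfolding maximal_sigs_def maximal_signatures_def signatures_eq maximal_iff_out_bits
      above[symmetric]
    by blast
  then show ?thesis using False by simp
qed

end

section \<open>The enumeration and its delay\<close>

definition punctual :: "nat \<Rightarrow> state \<Rightarrow> bool" where
  "punctual d s \<longleftrightarrow> successively (\<lambda>t u. u \<le> t + 2 * d) (0 # map fst (outs s)) \<and>
     clock s \<le> last (0 # map fst (outs s)) + d"

lemma punctual_output:
  assumes "punctual d s" "outs t = outs s @ [(u, x)]" "u \<le> clock s + d" "clock t \<le> u + d"
  shows "punctual d t"
proof -
  have "u \<le> last (0 # map fst (outs s)) + 2 * d"
    using assms(1,3) by (simp add: punctual_def)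
  then have "successively (\<lambda>t u. u \<le> t + 2 * d) ((0 # map fst (outs s)) @ [u])"
    unfolding successively_append_iff using assms(1) by (simp add: punctual_def)
  then show ?thesis using assms(2,4) by (simp add: punctual_def)
qed

lemma punctual_halt:
  assumes "punctual d s" "outs t = outs s" "clock t \<le> clock s + d"
  shows "delay_at_most (2 * d) t"
proof -
  have "clock t \<le> last (0 # map fst (outs s)) + 2 * d"
    using assms(1,3) by (simp add: punctual_def)
  then have "successively (\<lambda>t u. u \<le> t + 2 * d) ((0 # map fst (outs s)) @ [clock t])"
    unfolding successively_append_iff using assms(1) by (simp add: punctual_def)
  then show ?thesis using assms(2) by (simp add: delay_at_most_def)
qed

lemma delay_at_most_mono: "delay_at_most d s \<Longrightarrow> d \<le> d' \<Longrightarrow> delay_at_most d' s"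
  unfolding delay_at_most_def by (erule successively_mono) auto

lemma poly_nat_mono: "x \<le> y \<Longrightarrow> poly p x \<le> poly p y" for p :: "nat poly"
  by (induction p) (auto intro: add_mono mult_le_mono)

lemma word_size_le_input_size: "x \<in> set ws \<Longrightarrow> word_size x \<le> input_size ws"
  unfolding input_size_def by (rule member_le_sum_list) simp_all

lemma length_le_input_size: "length ws \<le> input_size ws"
proof (induction ws)
  case (Cons x ws)
  then show ?case using word_size_ge_1[of x] by (simp add: input_size_def)
qed simp

lemma less_exp_input_size: "x \<in> set ws \<Longrightarrow> x < 2 ^ input_size ws"
  using less_exp_word_size[of x] word_size_le_input_size
  by (meson less_le_trans one_le_numeral power_increasing)

lemma length_encode_cnf:
  assumes "two_xor_cnf \<phi>"
  shows "length \<phi> < length (encode_cnf \<phi>)" and "length (encode_cnf \<phi>) \<le> 4 * length \<phi> + 1"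
  using assms by (induction \<phi>) (auto simp: encode_cnf_def encode_clause_def two_xor_cnf_def)

definition prelude :: "instr list" where
  "prelude = [Load 3 0, Const 2 1, Add 4 3 2, Add 4 4 4, Add 4 4 4, Add 4 4 4]"

text \<open>
  Clearing the temporary registers after every iteration keeps the word length, which may grow
  with every step, from accumulating over exponentially many iterations.
\<close>

definition temporaries :: "nat list" where
  "temporaries = [0, 1] @ map reg_num [Edge, Clause, Index, Addr, Bit, Test, Old_label, New_label,
     Number, Flipped, Cursor, Unread]"

definition start_phase :: "bool \<Rightarrow> com" where
  "start_phase neg = Seq (instrs prelude) (Seq (compile (init_code neg)) (clear temporaries))"

definition output_phase :: "bool \<Rightarrow> com" where
  "output_phase neg = Seq (compile (output_code neg)) (Do Emit)"

definition expand_phase :: com where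
  "expand_phase = Seq (compile expand_code) (clear temporaries)"

definition enum_prog :: "bool \<Rightarrow> com" where
  "enum_prog neg = Seq (start_phase neg)
     (While (reg_num Pending) (Seq (output_phase neg) expand_phase))"

definition iteration_steps :: "bool \<Rightarrow> nat poly" where
  "iteration_steps neg = [:30:] + step_count (init_code neg) + step_count (output_code neg) +
     step_count expand_code"

lemma well_formed_code:
  "well_formed (init_code neg)" "well_formed (output_code neg)" "well_formed expand_code"
  by (auto simp: code_defs)

lemma silent_code: "Out \<notin> writes (init_code neg)" "Out \<notin> writes expand_code"
  by (auto simp: code_defs)

definition clear_env :: "(register, array) env \<Rightarrow> (register, array) env" where
  "clear_env e = e\<lparr>reg := (\<lambda>r. if r \<in> {Head, Tail, Pending} then reg e r else 0)\<rparr>"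

lemma runs_clear_temporaries:
  assumes "represents m B s e"
  shows "\<exists>t. runs 15 (clear temporaries) s t \<and> represents m B t (clear_env e) \<and>
    regs t 0 = 0 \<and> regs t 1 = 0"
proof -
  have "15 = length temporaries + 1" by (simp add: temporaries_def)
  then obtain t where cleared: "runs 15 (clear temporaries) s t"
    "regs t = (\<lambda>r. if r \<in> set temporaries then 0 else regs s r)" "mem t = mem s" "buf t = buf s"
    using runs_clear by blast
  have "reg_num r \<in> set temporaries \<longleftrightarrow> r \<notin> {Head, Tail, Pending}" for r
    by (cases r) (simp_all add: temporaries_def)
  moreover have "2 \<notin> set temporaries" "3 \<notin> set temporaries" "4 \<notin> set temporaries"
    by (simp_all add: temporaries_def)
  ultimately have "represents m B t (clear_env e)"
    using assms cleared(2-4) by (simp add: represents_def clear_env_def)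
  moreover have "regs t 0 = 0" "regs t 1 = 0"
    using cleared(2) by (simp_all add: temporaries_def)
  ultimately show ?thesis using cleared(1) by blast
qed

locale enumeration =
  fixes \<phi> :: xor_cnf and neg :: bool
  assumes two_xor_cnf: "two_xor_cnf \<phi>"
begin

abbreviation "m \<equiv> length \<phi>"

abbreviation "input \<equiv> mem (initial_state (encode_cnf \<phi>))"

definition input_bits :: nat where "input_bits = input_size (encode_cnf \<phi>)"

definition array_base :: nat where "array_base = 8 * (m + 1)"

definition word_bound :: nat where "word_bound = 2 * input_bits + 4"

definition phase_time :: nat where
  "phase_time = 2 * poly (iteration_steps neg) m * (word_bound + poly (iteration_steps neg) m)"

lemma length_less: "m < input_bits"
  using length_le_input_size[of "encode_cnf \<phi>"] length_encode_cnf(1)[OF two_xor_cnf]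
  by (simp add: input_bits_def)

end

sublocale enumeration \<subseteq> formula \<phi> neg "2 ^ input_bits"
  by unfold_locales (use two_xor_cnf less_exp_input_size in \<open>auto simp: input_bits_def\<close>)

context enumeration
begin

lemma input_less_exp: "input i < 2 ^ input_bits"
  using input_less by (auto simp: initial_state_def)

lemma input_above_base: "array_base \<le> i \<Longrightarrow> input i = 0"
  using length_encode_cnf(2)[OF two_xor_cnf] by (simp add: initial_state_def array_base_def)

definition phase_env :: "bool list list \<Rightarrow> nat \<Rightarrow> (register, array) env \<Rightarrow> bool" where
  "phase_env Q h e \<longleftrightarrow> search_env Q h e \<and> out e = [] \<and> inp e = input"

definition head_state :: "bool list list \<Rightarrow> nat \<Rightarrow> state \<Rightarrow> bool" where
  "head_state Q h s \<longleftrightarrow>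
     (\<exists>e. represents m array_base s (clear_env e) \<and> phase_env Q h (clear_env e)) \<and>
     regs s 0 = 0 \<and> regs s 1 = 0"

lemma head_stateE:
  assumes "head_state Q h s"
  obtains e where "represents m array_base s e" "phase_env Q h e"
    "\<And>r. r \<notin> {Head, Tail, Pending} \<Longrightarrow> reg e r = 0"
proof -
  obtain e where "represents m array_base s (clear_env e)" "phase_env Q h (clear_env e)"
    using assms by (auto simp: head_state_def)
  then show thesis using that[of "clear_env e"] by (simp add: clear_env_def)
qed

lemma phase_env_clear_env [simp]: "phase_env Q h (clear_env e) = phase_env Q h e"
  using search_env_cong[of "clear_env e" e] by (simp add: phase_env_def clear_env_def)

lemma clear_temporaries_head_state:
  assumes "represents m array_base s e" "phase_env Q h e"
  shows "\<exists>t. runs 15 (clear temporaries) s t \<and> head_state Q h t"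
  using runs_clear_temporaries[OF assms(1)] assms(2) by (auto simp: head_state_def)

subsection \<open>Word length between iterations\<close>

lemma length_queue:
  assumes "search_env Q h e"
  shows "length Q \<le> card maximal_sigs"
  using search_envD(1,2)[OF assms] card_mono[OF finite_maximal_sigs] distinct_card by metis

lemma less_exp_word_bound:
  assumes "x \<le> 8 * (2 ^ (2 * input_bits) :: nat)"
  shows "x < 2 ^ word_bound"
proof -
  have "(0::nat) < 2 ^ (2 * input_bits)" by simp
  then have "x < 16 * 2 ^ (2 * input_bits)" using assms by linarith
  then show ?thesis by (simp add: word_bound_def power_add)
qed

lemma exp_input_bits_le: "2 ^ input_bits \<le> (2 ^ (2 * input_bits) :: nat)"
  by (rule power_increasing) simp_all

lemma length_le_exp: "m + 1 \<le> 2 ^ input_bits"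
  using length_less less_exp[of input_bits] by linarith

lemma search_env_reg_less:
  assumes "search_env Q h e" "r \<in> {Head, Tail, Pending}"
  shows "reg e r < 2 ^ word_bound"
proof -
  have entries: "length Q \<le> 2 ^ input_bits"
    using length_queue[OF assms(1)] card_maximal_sigs length_less
    by (meson le_trans less_imp_le one_le_numeral power_increasing)
  moreover have "m \<le> 2 ^ input_bits" using length_le_exp by linarith
  ultimately have cells: "length Q * m \<le> 2 ^ (2 * input_bits)"
    using mult_le_mono by (fastforce simp: mult_2 power_add)
  have "h * m \<le> length Q * m"
    using search_envD(6)[OF assms(1)] by (intro mult_le_mono) linarith+
  then have "h * m \<le> 2 ^ (2 * input_bits)" using cells by (rule le_trans)
  moreover have "length Q \<le> 2 ^ (2 * input_bits)"
    using entries exp_input_bits_le by (rule le_trans)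
  moreover have "length (concat Q) = length Q * m"
    using search_envD(2)[OF assms(1)] length_maximal_sigs by (intro length_concat_uniform) blast
  ultimately have "reg e r \<le> 2 ^ (2 * input_bits)"
    using assms(2) cells search_envD(4-6)[OF assms(1)] by (auto simp: queue_env_def)
  then show ?thesis by (intro less_exp_word_bound) linarith
qed

lemma head_state_regs_less:
  assumes "head_state Q h s"
  shows "regs s i < 2 ^ word_bound"
proof (cases "i < 5")
  case True
  have "m + 1 \<le> 2 ^ (2 * input_bits)"
    using length_le_exp exp_input_bits_le by (rule le_trans)
  then have "1 \<le> 8 * (2 ^ (2 * input_bits) :: nat)" "m \<le> 8 * 2 ^ (2 * input_bits)"
      "array_base \<le> 8 * 2 ^ (2 * input_bits)"
    unfolding array_base_def by simp_all
  note small = this[THEN less_exp_word_bound]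
  from True consider "i = 0" | "i = 1" | "i = 2" | "i = 3" | "i = 4" by linarith
  then show ?thesis
    using assms small by cases (auto simp: represents_def head_state_def)
next
  case False
  obtain e where env: "represents m array_base s e" "phase_env Q h e"
    "\<And>r. r \<notin> {Head, Tail, Pending} \<Longrightarrow> reg e r = 0"
    using head_stateE[OF assms] by blast
  have "reg e r < 2 ^ word_bound" for r
    using search_env_reg_less[of Q h e r] env(2,3)
    by (cases "r \<in> {Head, Tail, Pending}") (auto simp: phase_env_def)
  then show ?thesis
    using env(1) False by (cases "i \<in> range reg_num") (auto simp: represents_def)
qed

lemma head_state_mem_less:
  assumes "head_state Q h s"
  shows "mem s a < 2 ^ word_bound"
proof -
  obtain e where env: "represents m array_base s e" "phase_env Q h e"
    using head_stateE[OF assms] by blast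
  have "arr e t i \<le> 2 ^ input_bits" for t i
    using env(2) by (auto simp: phase_env_def search_env_def graph_env_def cells_le_def)
  moreover have "inp e a \<le> 2 ^ input_bits"
    using env(2) input_less_exp[of a] by (simp add: phase_env_def)
  ultimately have "mem s a \<le> 2 ^ input_bits"
    using env(1)
    by (cases "a \<in> range (case_prod (cell array_base))") (auto simp: represents_def)
  with exp_input_bits_le show ?thesis by (intro less_exp_word_bound) linarith
qed

lemma head_state_bounded: "head_state Q h s \<Longrightarrow> bounded word_bound s"
  by (simp add: bounded_def head_state_regs_less head_state_mem_less)

lemma clock_le_phase_time:
  assumes "bounded word_bound s\<^sub>0" "grows k s\<^sub>0 s" "grows l s t"
    and "k + l \<le> poly (iteration_steps neg) m"
  shows "clock t \<le> clock s + phase_time"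
proof -
  have "3 \<le> word_bound" by (simp add: word_bound_def)
  then have "bounded (word_bound + k) s" using growsD(1) assms(1,2) by blast
  then have "clock t \<le> clock s + 2 * l * (word_bound + k + l)"
    using growsD(2)[OF assms(3)] \<open>3 \<le> word_bound\<close> by simp
  also have "2 * l * (word_bound + k + l) \<le> phase_time"
    unfolding phase_time_def using assms(4) by (intro mult_le_mono) auto
  finally show ?thesis by simp
qed

subsection \<open>The phases of the program\<close>

lemma output_phase_exec:
  assumes "represents m array_base s e" "phase_env Q h e" "h < length Q"
  shows "\<exists>t e'. exec (output_phase neg) s t \<and>
    grows (poly (step_count (output_code neg)) m + 1) s t \<and>
    outs t = outs s @ [(clock t, out_bits (Q ! h))] \<and>
    represents m array_base t e' \<and> phase_env Q h e'"
proof -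
  let ?e = "eval m (output_code neg) e" and ?n = "poly (step_count (output_code neg)) m"
  obtain s' where compiled: "runs ?n (compile (output_code neg)) s s'"
    "represents m array_base s' ?e"
    using compile_runs[OF well_formed_code(2) assms(1)] by blast
  have search: "search_env Q h e" "out e = []" using assms(2) by (simp_all add: phase_env_def)
  have written: "out ?e = out_bits (Q ! h)" "search_env Q h ?e" "inp ?e = input"
    using eval_output_code[OF search(1) assms(3) search(2)] assms(2)
    by (simp_all add: out_bits_def eval_frame phase_env_def)
  have "exec (output_phase neg) s (step Emit s')"
    using compiled(1) unfolding output_phase_def step_def runs_def by (blast intro: exec.intros)
  moreover have "grows (?n + 1) s (step Emit s')"
    by (rule grows_trans[OF _ grows_step]) (use compiled(1) in \<open>simp_all add: runs_def\<close>)
  moreover have "outs (step Emit s') = outs s @ [(clock (step Emit s'), out_bits (Q ! h))]"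
    using compiled written(1) by (simp add: step_def runs_def represents_def)
  moreover have "represents m array_base (step Emit s') (?e\<lparr>out := []\<rparr>)"
    using compiled(2) by (simp add: step_def represents_def)
  moreover have "phase_env Q h (?e\<lparr>out := []\<rparr>)"
    using written(2,3) search_env_cong[of "?e\<lparr>out := []\<rparr>" ?e] by (simp add: phase_env_def)
  ultimately show ?thesis by blast
qed

lemma expand_phase_runs:
  assumes "represents m array_base s e" "phase_env Q h e" "h < length Q"
  shows "\<exists>t. runs (poly (step_count expand_code) m + 15) expand_phase s t \<and>
    head_state (fold push (successors m (Q ! h)) Q) (Suc h) t"
proof -
  let ?e = "eval m expand_code e"
  obtain s' where compiled: "runs (poly (step_count expand_code) m) (compile expand_code) s s'"
    "represents m array_base s' ?e"
    using compile_runs[OF well_formed_code(3) assms(1)] by blast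
  have "phase_env (fold push (successors m (Q ! h)) Q) (Suc h) ?e"
    using eval_expand_code[of Q h e] assms(2,3) silent_code(2)
    by (simp add: phase_env_def eval_frame)
  then obtain t where "runs 15 (clear temporaries) s' t"
    "head_state (fold push (successors m (Q ! h)) Q) (Suc h) t"
    using clear_temporaries_head_state[OF compiled(2)] by blast
  with compiled(1) show ?thesis unfolding expand_phase_def by (blast intro: runs_Seq)
qed

lemma start_phase_runs:
  "\<exists>s. runs (22 + poly (step_count (init_code neg)) m) (start_phase neg)
      (initial_state (encode_cnf \<phi>)) s \<and>
    head_state [completion (\<lambda>_. False)] 0 s"
proof -
  let ?n = "poly (step_count (init_code neg)) m"
  let ?s\<^sub>0 = "initial_state (encode_cnf \<phi>)"
  define e :: "(register, array) env"
    where "e = \<lparr>reg = (\<lambda>_. 0), arr = (\<lambda>_ _. 0), inp = input, out = []\<rparr>"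
  have prelude: "runs 7 (instrs prelude) ?s\<^sub>0 (steps prelude ?s\<^sub>0)"
    by (rule runs_instrs) (simp_all add: prelude_def)
  have "input 0 = m" by (simp add: initial_state_def encode_cnf_def)
  moreover have "input (cell array_base t i) = 0" for t i
    by (rule input_above_base) (simp add: cell_def)
  ultimately have "represents m array_base (steps prelude ?s\<^sub>0) e"
    using input_above_base reg_num_ge
    by (simp add: represents_def steps_def step_def prelude_def e_def array_base_def
        initial_state_def)
  then obtain s where initialized: "runs ?n (compile (init_code neg)) (steps prelude ?s\<^sub>0) s"
    "represents m array_base s (eval m (init_code neg) e)"
    using compile_runs[OF well_formed_code(1)] by blast
  have "input_env e" by (simp add: input_env_def e_def initial_state_def)
  then have "phase_env [completion (\<lambda>_. False)] 0 (eval m (init_code neg) e)"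
    using eval_init_code[of e] silent_code(1) by (simp add: phase_env_def eval_frame e_def)
  then obtain t where cleared: "runs 15 (clear temporaries) s t"
    "head_state [completion (\<lambda>_. False)] 0 t"
    using clear_temporaries_head_state[OF initialized(2)] by blast
  have "runs (7 + (?n + 15)) (start_phase neg) ?s\<^sub>0 t"
    unfolding start_phase_def
    by (intro runs_Seq[OF prelude] runs_Seq[OF initialized(1) cleared(1)])
  with cleared(2) show ?thesis by auto
qed

lemma iteration_exec:
  assumes "head_state Q h s" "h < length Q"
  shows "\<exists>t u. exec (Seq (output_phase neg) expand_phase) (tick (word_size (regs s r)) s) t \<and>
    head_state (fold push (successors m (Q ! h)) Q) (Suc h) t \<and>
    outs t = outs s @ [(u, out_bits (Q ! h))] \<and>
    u \<le> clock s + phase_time \<and> clock t \<le> u + phase_time"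
proof -
  let ?s = "tick (word_size (regs s r)) s"
  have bounded: "bounded word_bound s" using assms(1) by (rule head_state_bounded)
  obtain e where "represents m array_base ?s e" "phase_env Q h e"
    using head_stateE[OF assms(1)] represents_tick by metis
  then obtain s' e' where emitted: "exec (output_phase neg) ?s s'"
      "grows (poly (step_count (output_code neg)) m + 1) ?s s'"
      "outs s' = outs ?s @ [(clock s', out_bits (Q ! h))]"
      "represents m array_base s' e'" "phase_env Q h e'"
    using output_phase_exec[OF _ _ assms(2)] by metis
  obtain t where expanded: "runs (poly (step_count expand_code) m + 15) expand_phase s' t"
      "head_state (fold push (successors m (Q ! h)) Q) (Suc h) t"
    using expand_phase_runs[OF emitted(4,5) assms(2)] by blast
  have grows: "grows (1 + (poly (step_count (output_code neg)) m + 1)) s s'"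
    by (rule grows_trans[OF grows_test emitted(2)])
  have "clock s' \<le> clock s + phase_time"
    by (rule clock_le_phase_time[OF bounded _ grows, of 0])
      (simp_all add: grows_def iteration_steps_def)
  moreover have "clock t \<le> clock s' + phase_time"
    by (rule clock_le_phase_time[OF bounded grows])
      (use expanded(1) in \<open>auto simp: runs_def iteration_steps_def\<close>)
  moreover have "exec (Seq (output_phase neg) expand_phase) ?s t"
    using emitted(1) expanded(1) unfolding runs_def by (blast intro: exec.Seq)
  moreover have "outs t = outs s @ [(clock s', out_bits (Q ! h))]"
    using expanded(1) emitted(3) by (simp add: runs_def)
  ultimately show ?thesis using expanded(2) by blast
qed

subsection \<open>Correctness\<close>

definition enum_state :: "bool list list \<Rightarrow> nat \<Rightarrow> state \<Rightarrow> bool" where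
  "enum_state Q h s \<longleftrightarrow> head_state Q h s \<and> Q \<noteq> [] \<and> punctual phase_time s \<and>
     map snd (outs s) = map out_bits (take h Q) \<and>
     (\<forall>\<sigma>\<in>set (take h Q). \<forall>v\<in>verts. completion (flip_sig v \<sigma>) \<in> set Q)"

lemma head_state_search:
  assumes "head_state Q h s"
  shows "length Q \<le> card maximal_sigs" "set Q \<subseteq> maximal_sigs" "distinct Q"
    "regs s (reg_num Pending) + h = length Q"
proof -
  obtain e where "represents m array_base s e" "search_env Q h e"
    using head_stateE[OF assms] unfolding phase_env_def by blast
  then show "length Q \<le> card maximal_sigs" "set Q \<subseteq> maximal_sigs" "distinct Q"
    "regs s (reg_num Pending) + h = length Q"
    using length_queue by (auto simp: search_env_def represents_def)
qed

lemma enum_state_start: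
  "\<exists>s. exec (start_phase neg) (initial_state (encode_cnf \<phi>)) s \<and>
    enum_state [completion (\<lambda>_. False)] 0 s"
proof -
  let ?s\<^sub>0 = "initial_state (encode_cnf \<phi>)"
  obtain s where
    started: "runs (22 + poly (step_count (init_code neg)) m) (start_phase neg) ?s\<^sub>0 s"
    "head_state [completion (\<lambda>_. False)] 0 s"
    using start_phase_runs by blast
  have "input_bits \<le> word_bound" by (simp add: word_bound_def)
  moreover have "bounded input_bits ?s\<^sub>0"
    using input_less_exp by (simp add: bounded_def) (simp add: initial_state_def)
  ultimately have "bounded word_bound ?s\<^sub>0" by (rule bounded_mono[rotated])
  moreover have "grows 0 ?s\<^sub>0 ?s\<^sub>0" by (simp add: grows_def)
  ultimately have "clock s \<le> clock ?s\<^sub>0 + phase_time"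
    using started(1) unfolding runs_def
    by (elim conjE clock_le_phase_time) (auto simp: iteration_steps_def)
  then have "punctual phase_time s" "outs s = []"
    using started(1) by (simp_all add: punctual_def runs_def initial_state_def)
  with started show ?thesis by (auto simp: enum_state_def runs_def)
qed

lemma enum_state_step:
  assumes "enum_state Q h s" "regs s (reg_num Pending) \<noteq> 0"
  shows "\<exists>t Q'. exec (Seq (output_phase neg) expand_phase)
      (tick (word_size (regs s (reg_num Pending))) s) t \<and> enum_state Q' (Suc h) t"
proof -
  let ?Q = "fold push (successors m (Q ! h)) Q"
  have head: "head_state Q h s" using assms(1) by (simp add: enum_state_def)
  have "h < length Q" using head_state_search(4)[OF head] assms(2) by simp
  obtain t u where iteration: "exec (Seq (output_phase neg) expand_phase)
      (tick (word_size (regs s (reg_num Pending))) s) t" "head_state ?Q (Suc h) t"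
    and outs: "outs t = outs s @ [(u, out_bits (Q ! h))]"
    and times: "u \<le> clock s + phase_time" "clock t \<le> u + phase_time"
    using iteration_exec[OF head \<open>h < length Q\<close>] by blast
  have "punctual phase_time t"
    using assms(1) by (intro punctual_output[OF _ outs times]) (simp add: enum_state_def)
  moreover obtain zs where extension: "?Q = Q @ zs" using fold_push_extends by blast
  then have "take (Suc h) ?Q = take h Q @ [Q ! h]"
    using \<open>h < length Q\<close> by (simp add: take_Suc_conv_app_nth)
  moreover have "completion (flip_sig v \<sigma>) \<in> set ?Q"
    if "\<sigma> \<in> set (take h Q @ [Q ! h])" "v \<in> verts" for \<sigma> v
    using that assms(1) by (auto simp: enum_state_def set_fold_push set_successors)
  moreover have "?Q \<noteq> []" using \<open>h < length Q\<close> extension by auto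
  ultimately have "enum_state ?Q (Suc h) t"
    using assms(1) iteration(2) outs unfolding enum_state_def by simp
  with iteration(1) show ?thesis by blast
qed

lemma enum_state_halt:
  assumes "enum_state Q h s" "regs s (reg_num Pending) = 0"
  shows "delay_at_most (2 * phase_time) (tick (word_size (regs s (reg_num Pending))) s)"
    and "distinct (map snd (outs s))" and "set (map snd (outs s)) = out_bits ` maximal_sigs"
proof -
  have head: "head_state Q h s" using assms(1) by (simp add: enum_state_def)
  have "h = length Q" using head_state_search(4)[OF head] assms(2) by simp
  then have outs: "map snd (outs s) = map out_bits Q"
    and closed: "\<forall>\<sigma>\<in>set Q. \<forall>v\<in>verts. completion (flip_sig v \<sigma>) \<in> set Q"
    using assms(1) by (simp_all add: enum_state_def)
  have "set Q = maximal_sigs"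
    by (rule closed_maximal_sigs)
      (use head_state_search(2)[OF head] assms(1) closed in \<open>auto simp: enum_state_def\<close>)
  then show "set (map snd (outs s)) = out_bits ` maximal_sigs" by (simp only: outs set_map)
  show "distinct (map snd (outs s))"
    unfolding outs using head_state_search(3)[OF head] inj_out_bits
    by (auto simp: distinct_map intro: inj_on_subset)
  show "delay_at_most (2 * phase_time) (tick (word_size (regs s (reg_num Pending))) s)"
  proof (rule punctual_halt)
    show "punctual phase_time s" using assms(1) by (simp add: enum_state_def)
    show "clock (tick (word_size (regs s (reg_num Pending))) s) \<le> clock s + phase_time"
      by (rule clock_le_phase_time[OF head_state_bounded[OF head] _ grows_test, of 0])
        (simp_all add: grows_def iteration_steps_def)
  qed simp
qed

lemma enum_loop:
  assumes "enum_state Q h s"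
  shows "\<exists>t. exec (While (reg_num Pending) (Seq (output_phase neg) expand_phase)) s t \<and>
    delay_at_most (2 * phase_time) t \<and> distinct (map snd (outs t)) \<and>
    set (map snd (outs t)) = out_bits ` maximal_sigs"
  using assms
proof (induction "card maximal_sigs - h" arbitrary: Q h s rule: less_induct)
  case less
  show ?case
  proof (cases "regs s (reg_num Pending) = 0")
    case True
    show ?thesis
      using enum_state_halt[OF less.prems True] exec.WhileFalse[OF True] by fastforce
  next
    case False
    obtain t Q' where iterated: "exec (Seq (output_phase neg) expand_phase)
        (tick (word_size (regs s (reg_num Pending))) s) t" "enum_state Q' (Suc h) t"
      using enum_state_step[OF less.prems False] by blast
    have "head_state Q' (Suc h) t" using iterated(2) by (simp add: enum_state_def)
    then have "Suc h \<le> card maximal_sigs" using head_state_search(1,4)[of Q' "Suc h" t] by simp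
    then have "card maximal_sigs - Suc h < card maximal_sigs - h" by simp
    from less.hyps[OF this iterated(2)] show ?thesis
      using exec.WhileTrue[OF False iterated(1)] by blast
  qed
qed

lemma enum_prog_correct:
  "\<exists>t. exec (enum_prog neg) (initial_state (encode_cnf \<phi>)) t \<and> delay_at_most (2 * phase_time) t \<and>
    distinct (map snd (outs t)) \<and>
    set (map snd (outs t)) = (if neg then minimal_signatures \<phi> else maximal_signatures \<phi>)"
proof -
  obtain s where started: "exec (start_phase neg) (initial_state (encode_cnf \<phi>)) s"
    "enum_state [completion (\<lambda>_. False)] 0 s"
    using enum_state_start by blast
  from enum_loop[OF started(2)] started(1) show ?thesis
    unfolding enum_prog_def out_bits_maximal_sigs by (blast intro: exec.Seq)
qed

end

lemma enum_prog_poly_delay: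
  "enumerates_with_poly_delay (enum_prog neg) {\<phi>. two_xor_cnf \<phi>} encode_cnf
     (\<lambda>\<phi>. if neg then minimal_signatures \<phi> else maximal_signatures \<phi>)"
proof -
  let ?q = "iteration_steps neg"
  let ?p = "[:4:] * ?q * ([:4, 2:] + ?q)"
  have "\<exists>s. exec (enum_prog neg) (initial_state (encode_cnf \<phi>)) s \<and>
      distinct (map snd (outs s)) \<and>
      set (map snd (outs s)) = (if neg then minimal_signatures \<phi> else maximal_signatures \<phi>) \<and>
      delay_at_most (poly ?p (input_size (encode_cnf \<phi>))) s" if "two_xor_cnf \<phi>" for \<phi>
  proof -
    interpret enumeration \<phi> neg by unfold_locales fact
    have "poly ?q m \<le> poly ?q input_bits"
      using length_less by (intro poly_nat_mono) simp
    then have "phase_time \<le> 2 * poly ?q input_bits * (word_bound + poly ?q input_bits)"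
      unfolding phase_time_def by (intro mult_le_mono) auto
    then have "2 * phase_time \<le> poly ?p input_bits"
      by (simp add: word_bound_def algebra_simps)
    then show ?thesis
      using enum_prog_correct delay_at_most_mono unfolding input_bits_def by blast
  qed
  then show ?thesis unfolding enumerates_with_poly_delay_def by blast
qed

theorem theorem3:
  shows "(\<exists>c. enumerates_with_poly_delay c {\<phi>. two_xor_cnf \<phi>} encode_cnf maximal_signatures) \<and>
         (\<exists>c. enumerates_with_poly_delay c {\<phi>. two_xor_cnf \<phi>} encode_cnf minimal_signatures)"
  using enum_prog_poly_delay[of False] enum_prog_poly_delay[of True] by auto

end
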